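(* Let $n\ge1$ and let $c_0,c_1,\dots,c_n$ be complex numbers with $c_i\ne0$ for $i=1,\dots,n$, $\sigma=c_0+c_1+\dots+c_n\ne0$, and $c_j+c_0\neq0$ for all $j=1,\dots,n$. Then the $\vee$-system $$B_n(c)=\{\sqrt{c_ic_j}\,(e_i\pm e_j),\ 1\le i<j\le n;\quad \sqrt{2c_i(c_i+c_0)}\,e_i,\ 1\le i\le n\}$$ is harmonic, with the potentials of the corresponding polynomial solutions given by $$F_k(x_1,\dots,x_n)=\frac1{2\pi i}\int_\gamma\prod_{j=1}^n(x^2-x_j^2)^{\lambda_j}\,x^{2\lambda_0}\,dx,\qquad k=1,\dots,n,$$ where $\lambda_i=(2k-1)\frac{c_i}{2\sigma}$ for $i=0,\dots,n$ and $\gamma$ is a large circle. The value of $\kappa$ corresponding to $F_k$ is $2k-1$.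
   Context: **$\vee$-systems.** Let $V$ be a finite-dimensional complex vector space. A finite set $\mathcal A\subset V^*$ of pairwise non-collinear covectors spanning $V^*$, with canonical form $G_{\mathcal A}(x,y)=\sum_{\alpha\in\mathcal A}\alpha(x)\alpha(y)$ non-degenerate, is a $\vee$-system if, with $\alpha^\vee\in V$ defined by $G_{\mathcal A}(\alpha^\vee,x)=\alpha(x)$, for every $\alpha\in\mathcal A$ and every two-dimensional subspace $\Pi\subset V^*$ containing $\alpha$ one has $\sum_{\beta\in\Pi\cap\mathcal A}\beta(\alpha^\vee)\beta^\vee=\nu\alpha^\vee$ for some $\nu\in\mathbb C$. **Harmonic $\vee$-systems.** For $\kappa\in\mathbb C$ consider the system $$( * )_\kappa\qquad \partial_\xi\psi(x)=\kappa\sum_{\alpha\in\mathcal A}\frac{\alpha(\xi)\,\alpha(\psi(x))}{\alpha(x)}\,\alpha^\vee,\qquad \xi\in V,\ x\in V\setminus\bigcup_{\alpha\in\mathcal A}\{\alpha=0\},$$ for a vector field $\psi$. A $\vee$-system of rank $n=\dim V$ is harmonic if there are nonzero $\kappa_1,\dots,\kappa_n$ and polynomial vector fields $\psi^{(1)},\dots,\psi^{(n)}$, linearly independent at a generic point, such that $\psi^{(i)}$ solves $( * )_{\kappa_i}$ and $\kappa_1+\dots+\kappa_n=|\mathcal A|$. The potential of a polynomial solution $\psi$ is a polynomial $F$ on $V$ with $\partial_\eta F=G_{\mathcal A}(\psi,\eta)$ for all $\eta\in V$; it satisfies $\partial_\xi\partial_\eta F=\kappa\sum_{\alpha\in\mathcal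 A}\frac{\alpha(\xi)\alpha(\eta)}{\alpha(x)}\partial_{\alpha^\vee}F$. Here $V=\mathbb C^n$ with coordinates $x_1,\dots,x_n$, and $e_i$ are the coordinate covectors. That $B_n(c)$ is a $\vee$-system is known. **The integrals.** For $\gamma$ a counterclockwise circle of large radius, the integrand is the single-valued function $x^{2k-1}\prod_{j=1}^n(1-x_j^2/x^2)^{\lambda_j}$ (principal branches; note $2\sum_{j=0}^n\lambda_j=2k-1$), so $F_k$ is the coefficient of $x^{-1}$ in its expansion at infinity. *)

theory Defs
  imports "HOL-Complex_Analysis.Complex_Analysis"
begin

text \<open>
  \<open>V\<close> is \<open>complex ^ 'n\<close>. A covector is represented by its coefficient vector with respect to
  the coordinate covectors, so \<open>axis i 1\<close> is the \<open>i\<close>-th coordinate covector when it is read as an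
  element of the dual space. Evaluation is complex bilinear, unlike the inner product
  \<open>(\<bullet>)\<close> of the library.
\<close>

definition ev :: "complex ^ 'n \<Rightarrow> complex ^ 'n \<Rightarrow> complex" where
  "ev \<alpha> x = (\<Sum>i\<in>UNIV. \<alpha> $ i * x $ i)"

definition canonical_form :: "(complex ^ 'n) set \<Rightarrow> complex ^ 'n \<Rightarrow> complex ^ 'n \<Rightarrow> complex" where
  "canonical_form A x y = (\<Sum>\<alpha>\<in>A. ev \<alpha> x * ev \<alpha> y)"

definition nondegenerate_form :: "(complex ^ 'n \<Rightarrow> complex ^ 'n \<Rightarrow> complex) \<Rightarrow> bool" where
  "nondegenerate_form G \<longleftrightarrow> (\<forall>x. (\<forall>y. G x y = 0) \<longrightarrow> x = 0)"

definition dual_vec :: "(complex ^ 'n) set \<Rightarrow> complex ^ 'n \<Rightarrow> complex ^ 'n" where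
  "dual_vec A \<alpha> = (THE v. \<forall>x. canonical_form A v x = ev \<alpha> x)"

definition vee_system :: "(complex ^ 'n) set \<Rightarrow> bool" where
  "vee_system A \<longleftrightarrow>
     finite A \<and>
     (\<forall>\<alpha>\<in>A. \<forall>\<beta>\<in>A. \<alpha> \<noteq> \<beta> \<longrightarrow> vec.independent {\<alpha>, \<beta>}) \<and>
     vec.span A = UNIV \<and>
     nondegenerate_form (canonical_form A) \<and>
     (\<forall>\<alpha>\<in>A. \<forall>P. vec.subspace P \<and> vec.dim P = 2 \<and> \<alpha> \<in> P \<longrightarrow>
        (\<exists>\<nu>. (\<Sum>\<beta>\<in>P \<inter> A. ev \<beta> (dual_vec A \<alpha>) *s dual_vec A \<beta>) = \<nu> *s dual_vec A \<alpha>))"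

definition polynomial_map :: "(complex ^ 'n \<Rightarrow> complex) \<Rightarrow> bool" where
  "polynomial_map f \<longleftrightarrow>
     (\<exists>(M :: ('n \<Rightarrow> nat) set) a. finite M \<and>
        (\<forall>x. f x = (\<Sum>m\<in>M. a m * (\<Prod>i\<in>UNIV. (x $ i) ^ m i))))"

definition polynomial_field :: "(complex ^ 'n \<Rightarrow> complex ^ 'n) \<Rightarrow> bool" where
  "polynomial_field \<psi> \<longleftrightarrow> (\<forall>i. polynomial_map (\<lambda>x. \<psi> x $ i))"

definition has_dir_deriv ::
    "(complex ^ 'n \<Rightarrow> complex) \<Rightarrow> complex ^ 'n \<Rightarrow> complex ^ 'n \<Rightarrow> complex \<Rightarrow> bool" where
  "has_dir_deriv f \<xi> x d \<longleftrightarrow> ((\<lambda>t. f (x + t *s \<xi>)) has_field_derivative d) (at 0)"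

definition solves_system ::
    "(complex ^ 'n) set \<Rightarrow> complex \<Rightarrow> (complex ^ 'n \<Rightarrow> complex ^ 'n) \<Rightarrow> bool" where
  "solves_system A \<kappa> \<psi> \<longleftrightarrow>
     (\<forall>\<xi> x. (\<forall>\<alpha>\<in>A. ev \<alpha> x \<noteq> 0) \<longrightarrow>
        (\<forall>i. has_dir_deriv (\<lambda>y. \<psi> y $ i) \<xi> x
               ((\<kappa> *s (\<Sum>\<alpha>\<in>A. (ev \<alpha> \<xi> * ev \<alpha> (\<psi> x) / ev \<alpha> x) *s dual_vec A \<alpha>)) $ i)))"

text \<open>A property holds at a generic point if it holds off the zero set of a nonzero polynomial.\<close>

definition generically :: "(complex ^ 'n \<Rightarrow> bool) \<Rightarrow> bool" where
  "generically Q \<longleftrightarrow>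
     (\<exists>p. polynomial_map p \<and> (\<exists>x. p x \<noteq> 0) \<and> (\<forall>x. p x \<noteq> 0 \<longrightarrow> Q x))"

text \<open>Injectivity is needed because the \<open>\<psi> k x\<close> are meant to be independent as a family.\<close>

definition harmonic_data ::
    "(complex ^ 'n) set \<Rightarrow> (nat \<Rightarrow> complex) \<Rightarrow> (nat \<Rightarrow> complex ^ 'n \<Rightarrow> complex ^ 'n) \<Rightarrow> bool" where
  "harmonic_data A \<kappa> \<psi> \<longleftrightarrow>
     (\<forall>k\<in>{1..CARD('n)}. \<kappa> k \<noteq> 0 \<and> polynomial_field (\<psi> k) \<and> solves_system A (\<kappa> k) (\<psi> k)) \<and>
     generically (\<lambda>x. inj_on (\<lambda>k. \<psi> k x) {1..CARD('n)} \<and>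
                      vec.independent ((\<lambda>k. \<psi> k x) ` {1..CARD('n)})) \<and>
     (\<Sum>k=1..CARD('n). \<kappa> k) = of_nat (card A)"

definition harmonic :: "(complex ^ 'n) set \<Rightarrow> bool" where
  "harmonic A \<longleftrightarrow> vee_system A \<and> (\<exists>\<kappa> \<psi>. harmonic_data A \<kappa> \<psi>)"

definition is_potential ::
    "(complex ^ 'n) set \<Rightarrow> (complex ^ 'n \<Rightarrow> complex ^ 'n) \<Rightarrow> (complex ^ 'n \<Rightarrow> complex) \<Rightarrow> bool" where
  "is_potential A \<psi> F \<longleftrightarrow>
     polynomial_map F \<and> (\<forall>\<eta> x. has_dir_deriv F \<eta> x (canonical_form A (\<psi> x) \<eta>))"

text \<open>
  The index type is linearly ordered only to select one covector of each pair
  \<open>\<plusminus>(e\<^sub>i - e\<^sub>j)\<close>. The principal square root is used; another choice of roots changes signs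
  of covectors only.
\<close>

definition B_system ::
    "complex \<Rightarrow> ('n \<Rightarrow> complex) \<Rightarrow> (complex ^ 'n::{finite,linorder}) set" where
  "B_system c\<^sub>0 c =
     {csqrt (c i * c j) *s (axis i 1 + axis j 1) | i j. i < j} \<union>
     {csqrt (c i * c j) *s (axis i 1 - axis j 1) | i j. i < j} \<union>
     {csqrt (2 * c i * (c i + c\<^sub>0)) *s axis i 1 | i. True}"

definition B_exponent :: "complex \<Rightarrow> ('n::finite \<Rightarrow> complex) \<Rightarrow> nat \<Rightarrow> complex \<Rightarrow> complex" where
  "B_exponent c\<^sub>0 c k a = (2 * of_nat k - 1) * a / (2 * (c\<^sub>0 + (\<Sum>i\<in>UNIV. c i)))"

text \<open>
  With \<open>\<lambda>\<^sub>0 = B_exponent c\<^sub>0 c k c\<^sub>0\<close> and \<open>\<lambda>\<^sub>j = B_exponent c\<^sub>0 c k (c j)\<close> one has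
  \<open>2 * (\<lambda>\<^sub>0 + (\<Sum>j. \<lambda>\<^sub>j)) = 2 * k - 1\<close>. So the following is the single-valued branch of
  \<open>(\<Prod>j. (z\<^sup>2 - x\<^sub>j\<^sup>2) powr \<lambda>\<^sub>j) * z powr (2 * \<lambda>\<^sub>0)\<close> on the region where \<open>\<bar>z\<bar> > \<bar>x\<^sub>j\<bar>\<close> for
  all \<open>j\<close>; there every base of \<open>powr\<close> has positive real part.
\<close>

definition B_integrand ::
    "complex \<Rightarrow> ('n::finite \<Rightarrow> complex) \<Rightarrow> nat \<Rightarrow> complex ^ 'n \<Rightarrow> complex \<Rightarrow> complex" where
  "B_integrand c\<^sub>0 c k x z =
     z ^ (2 * k - 1) * (\<Prod>j\<in>UNIV. (1 - (x $ j)\<^sup>2 / z\<^sup>2) powr B_exponent c\<^sub>0 c k (c j))"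

end

theory Submission imports Defs begin

text \<open>
  With \<open>\<lambda>\<^sub>j\<close> proportional to \<open>c\<^sub>j\<close>, the potential \<open>F\<^sub>k\<close> is the coefficient of \<open>X\<^sup>k\<close> in the formal power
  series \<open>\<Phi> = \<Prod>\<^sub>j (1 - x\<^sub>j\<^sup>2 X) powr \<lambda>\<^sub>j\<close>, where \<open>X = 1/z\<^sup>2\<close>. The logarithmic derivative of \<open>\<Phi>\<close> in \<open>x\<^sub>i\<close> is
  \<open>- 2 \<lambda>\<^sub>i x\<^sub>i X / (1 - x\<^sub>i\<^sup>2 X)\<close>, and partial fractions give the mixed second derivatives of \<open>F\<^sub>k\<close>. The
  pure second derivatives follow from them by Euler's identity, because \<open>F\<^sub>k\<close> is homogeneous of
  degree \<open>2k\<close>; so no integration by parts is needed. Moreover \<open>\<partial>\<^sub>i F\<^sub>k\<close> is \<open>- 2 \<lambda>\<^sub>i x\<^sub>i\<close> times a monic polynomial of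
  degree \<open>k - 1\<close> in \<open>x\<^sub>i\<^sup>2\<close> whose coefficients do not depend on \<open>i\<close>, and independence is a Vandermonde
  argument.

  In the \<open>\<or>\<close>-condition at \<open>\<alpha>\<close> the contributions cancel for every subspace that contains \<open>\<alpha>\<close>,
  whatever its dimension.
\<close>

no_notation fps_nth (infixl "$" 75)

section \<open>Polynomial maps\<close>

text \<open>The representation in \<open>polynomial_map\<close> lists each exponent vector once.
  Sums and products produce repeated monomials, whose coefficients are merged here along the fibres
  of \<open>e\<close>.\<close>

lemma polynomial_map_sum_monomials:
  fixes e :: "'k \<Rightarrow> 'n::finite \<Rightarrow> nat"
  assumes "finite I"
  shows "polynomial_map (\<lambda>x. \<Sum>k\<in>I. a k * (\<Prod>i\<in>UNIV. (x $ i) ^ e k i))"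
  unfolding polynomial_map_def
proof (intro exI conjI allI)
  show "finite (e ` I)" using assms by simp
  fix x :: "complex ^ 'n"
  have "(\<Sum>k\<in>I. a k * (\<Prod>i\<in>UNIV. (x $ i) ^ e k i))
      = (\<Sum>m\<in>e ` I. \<Sum>k\<in>{k. k \<in> I \<and> e k = m}. a k * (\<Prod>i\<in>UNIV. (x $ i) ^ e k i))"
    by (rule sum.image_gen[OF assms])
  also have "\<dots> = (\<Sum>m\<in>e ` I. (\<Sum>k\<in>{k. k \<in> I \<and> e k = m}. a k) * (\<Prod>i\<in>UNIV. (x $ i) ^ m i))"
    by (simp add: sum_distrib_right)
  finally show "(\<Sum>k\<in>I. a k * (\<Prod>i\<in>UNIV. (x $ i) ^ e k i))
      = (\<Sum>m\<in>e ` I. (\<Sum>k\<in>{k. k \<in> I \<and> e k = m}. a k) * (\<Prod>i\<in>UNIV. (x $ i) ^ m i))" .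
qed

lemma polynomial_map_const: "polynomial_map (\<lambda>x :: complex ^ 'n::finite. a)"
  using polynomial_map_sum_monomials[of "{()}" "\<lambda>_. a" "\<lambda>_ _. 0"] by simp

lemma polynomial_map_component: "polynomial_map (\<lambda>x :: complex ^ 'n::finite. x $ i)"
proof -
  have "(\<Prod>j\<in>UNIV. (x $ j) ^ (if j = i then 1 else 0)) = x $ i" for x :: "complex ^ 'n"
    by (subst prod.remove[of _ i]) auto
  then show ?thesis
    using polynomial_map_sum_monomials[of "{()}" "\<lambda>_. 1" "\<lambda>_ j. if j = i then 1 else 0"] by simp
qed

lemma polynomial_map_add:
  fixes f g :: "complex ^ 'n::finite \<Rightarrow> complex"
  assumes "polynomial_map f" "polynomial_map g"
  shows "polynomial_map (\<lambda>x. f x + g x)"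
proof -
  obtain M :: "('n \<Rightarrow> nat) set" and a where M: "finite M"
      "\<And>x. f x = (\<Sum>m\<in>M. a m * (\<Prod>i\<in>UNIV. (x $ i) ^ m i))"
    using assms(1) unfolding polynomial_map_def by blast
  obtain N :: "('n \<Rightarrow> nat) set" and b where N: "finite N"
      "\<And>x. g x = (\<Sum>m\<in>N. b m * (\<Prod>i\<in>UNIV. (x $ i) ^ m i))"
    using assms(2) unfolding polynomial_map_def by blast
  have "polynomial_map (\<lambda>x. \<Sum>k\<in>M <+> N. case_sum a b k * (\<Prod>i\<in>UNIV. (x $ i) ^ case_sum id id k i))"
    using M(1) N(1) by (intro polynomial_map_sum_monomials) simp
  then show ?thesis
    using M(1) N(1) by (simp add: sum.Plus M(2) N(2))
qed

lemma polynomial_map_mult: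
  fixes f g :: "complex ^ 'n::finite \<Rightarrow> complex"
  assumes "polynomial_map f" "polynomial_map g"
  shows "polynomial_map (\<lambda>x. f x * g x)"
proof -
  obtain M :: "('n \<Rightarrow> nat) set" and a where M: "finite M"
      "\<And>x. f x = (\<Sum>m\<in>M. a m * (\<Prod>i\<in>UNIV. (x $ i) ^ m i))"
    using assms(1) unfolding polynomial_map_def by blast
  obtain N :: "('n \<Rightarrow> nat) set" and b where N: "finite N"
      "\<And>x. g x = (\<Sum>m\<in>N. b m * (\<Prod>i\<in>UNIV. (x $ i) ^ m i))"
    using assms(2) unfolding polynomial_map_def by blast
  have "polynomial_map (\<lambda>x. \<Sum>k\<in>M \<times> N. (a (fst k) * b (snd k)) *
          (\<Prod>i\<in>UNIV. (x $ i) ^ (fst k i + snd k i)))"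
    using M(1) N(1) by (intro polynomial_map_sum_monomials) simp
  moreover have "f x * g x = (\<Sum>k\<in>M \<times> N. (a (fst k) * b (snd k)) *
          (\<Prod>i\<in>UNIV. (x $ i) ^ (fst k i + snd k i)))" for x
    unfolding M(2) N(2) sum_product sum.cartesian_product
    by (intro sum.cong refl) (auto simp: power_add prod.distrib mult_ac)
  ultimately show ?thesis by simp
qed

lemma polynomial_map_power:
  "polynomial_map f \<Longrightarrow> polynomial_map (\<lambda>x :: complex ^ 'n::finite. f x ^ m)"
  by (induction m) (simp_all add: polynomial_map_mult polynomial_map_const)

lemma polynomial_map_diff:
  fixes f g :: "complex ^ 'n::finite \<Rightarrow> complex"
  assumes "polynomial_map f" "polynomial_map g"
  shows "polynomial_map (\<lambda>x. f x - g x)"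
  using polynomial_map_add[OF assms(1) polynomial_map_mult[OF polynomial_map_const[of "- 1"] assms(2)]]
  by simp

lemma polynomial_map_sum:
  "(\<And>k. k \<in> I \<Longrightarrow> polynomial_map (f k)) \<Longrightarrow>
    polynomial_map (\<lambda>x :: complex ^ 'n::finite. \<Sum>k\<in>I. f k x)"
  by (induction I rule: infinite_finite_induct)
    (simp_all add: polynomial_map_add polynomial_map_const)

lemma polynomial_map_prod:
  "(\<And>k. k \<in> I \<Longrightarrow> polynomial_map (f k)) \<Longrightarrow>
    polynomial_map (\<lambda>x :: complex ^ 'n::finite. \<Prod>k\<in>I. f k x)"
  by (induction I rule: infinite_finite_induct)
    (simp_all add: polynomial_map_mult polynomial_map_const)

lemmas polynomial_map_intros =
  polynomial_map_const polynomial_map_component polynomial_map_add polynomial_map_mult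
  polynomial_map_power polynomial_map_diff polynomial_map_sum polynomial_map_prod

section \<open>The covectors\<close>

text \<open>Both sides have two-element support, so {i, j} = {i', j'}; the order of the indices
  matches them up, and the ratio of the two nonzero coordinates is the sign.\<close>

lemma pair_collinearD:
  fixes i j i' j' :: "'n::{finite,linorder}" and a b s s' :: complex
  assumes "a *s (axis i 1 + s *s axis j 1) = b *s (axis i' 1 + s' *s axis j' 1)"
    and "i < j" "i' < j'" "s \<noteq> 0" "s' \<noteq> 0" "a \<noteq> 0"
  shows "i = i'" "j = j'" "s = s'"
proof -
  have eq: "a * ((if l = i then 1 else 0) + s * (if l = j then 1 else 0))
      = b * ((if l = i' then 1 else 0) + s' * (if l = j' then 1 else 0))" for l
    using arg_cong[OF assms(1), of "\<lambda>v. v $ l"]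
    by (simp only: axis_def vector_smult_component vector_add_component vec_lambda_beta)
  have "i = i' \<or> i = j'"
    using eq[of i] assms(2,6) by (auto split: if_splits)
  moreover have "j = i' \<or> j = j'"
    using eq[of j] assms(2,4,6) by (auto split: if_splits)
  ultimately show ij: "i = i'" "j = j'"
    using assms(2,3) by auto
  have "i \<noteq> j" using assms(2) by simp
  then show "s = s'"
    using eq[of i] eq[of j] assms(6) ij by auto
qed

lemma pair_axis_not_collinear:
  fixes i j i' :: "'n::{finite,linorder}" and a b s :: complex
  assumes "i < j" "s \<noteq> 0" "a \<noteq> 0"
  shows "a *s (axis i 1 + s *s axis j 1) \<noteq> b *s axis i' 1"
proof
  assume *: "a *s (axis i 1 + s *s axis j 1) = b *s axis i' 1"
  have eq: "a * ((if l = i then 1 else 0) + s * (if l = j then 1 else 0))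
      = b * (if l = i' then 1 else 0)" for l
    using arg_cong[OF *, of "\<lambda>v. v $ l"]
    by (simp only: axis_def vector_smult_component vector_add_component vec_lambda_beta)
  show False
    using eq[of i] eq[of j] assms by (auto split: if_splits)
qed

lemma axis_collinearD:
  fixes i i' :: "'n::finite" and a b :: complex
  assumes "a *s axis i 1 = b *s axis i' 1" "a \<noteq> 0"
  shows "i = i'"
  using arg_cong[OF assms(1), of "\<lambda>v. v $ i"] assms(2) by (auto simp: axis_def split: if_splits)

section \<open>The parameters and the normalised covectors\<close>

locale B_parameters =
  fixes c\<^sub>0 :: complex and c :: "'n::{finite,linorder} \<Rightarrow> complex"
  assumes c_nonzero: "\<And>i. c i \<noteq> 0"
    and sigma_nonzero: "c\<^sub>0 + (\<Sum>i\<in>UNIV. c i) \<noteq> 0"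
    and c_add_nonzero: "\<And>j. c j + c\<^sub>0 \<noteq> 0"
begin

definition \<sigma> :: complex where
  "\<sigma> = c\<^sub>0 + (\<Sum>i\<in>UNIV. c i)"

lemma sigma_neq_0: "\<sigma> \<noteq> 0"
  using sigma_nonzero by (simp add: \<sigma>_def)

text \<open>The sign \<open>s\<close> is a parameter so that one argument serves both families e_i +
  e_j and e_i - e_j.\<close>

definition pair_cov :: "complex \<Rightarrow> 'n \<times> 'n \<Rightarrow> (complex, 'n) vec" where
  "pair_cov s p = csqrt (c (fst p) * c (snd p)) *s (axis (fst p) 1 + s *s axis (snd p) 1)"

definition axis_cov :: "'n \<Rightarrow> (complex, 'n) vec" where
  "axis_cov i = csqrt (2 * c i * (c i + c\<^sub>0)) *s axis i 1"

abbreviation pairs :: "('n \<times> 'n) set" where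
  "pairs \<equiv> {(i, j). i < j}"

lemma B_system_eq:
  "B_system c\<^sub>0 c = pair_cov 1 ` pairs \<union> pair_cov (- 1) ` pairs \<union> range axis_cov"
proof -
  have "{csqrt (c i * c j) *s (axis i 1 + axis j 1) | i j. i < j} = pair_cov 1 ` pairs"
    by (auto simp: pair_cov_def image_def)
  moreover have "{csqrt (c i * c j) *s (axis i 1 - axis j 1) | i j. i < j} = pair_cov (- 1) ` pairs"
    by (auto simp: pair_cov_def image_def)
  moreover have "{csqrt (2 * c i * (c i + c\<^sub>0)) *s axis i 1 | i. True} = range axis_cov"
    by (auto simp: axis_cov_def)
  ultimately show ?thesis unfolding B_system_def by simp
qed

lemma pair_cov_collinearD:
  assumes "pair_cov s p = t *s pair_cov s' q" "p \<in> pairs" "q \<in> pairs" "s \<noteq> 0" "s' \<noteq> 0"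
  shows "p = q" "s = s'"
proof -
  have *: "csqrt (c (fst p) * c (snd p)) *s (axis (fst p) 1 + s *s axis (snd p) 1)
     = (t * csqrt (c (fst q) * c (snd q))) *s (axis (fst q) 1 + s' *s axis (snd q) 1)"
    using assms(1) by (simp add: pair_cov_def vec.scale_scale)
  note D = pair_collinearD[OF *]
  show "p = q" "s = s'"
    using D assms c_nonzero by (auto simp: prod_eq_iff)
qed

lemma pair_axis_cov_not_collinear:
  assumes "p \<in> pairs" "s \<noteq> 0"
  shows "pair_cov s p \<noteq> t *s axis_cov i"
  using pair_axis_not_collinear[of "fst p" "snd p" s] assms c_nonzero
  by (auto simp: pair_cov_def axis_cov_def vec.scale_scale)

lemma axis_cov_collinearD: "axis_cov i = t *s axis_cov j \<Longrightarrow> i = j"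
  using axis_collinearD[of "csqrt (2 * c i * (c i + c\<^sub>0))" i _ j] c_nonzero c_add_nonzero
  by (auto simp: axis_cov_def vec.scale_scale)

lemma pair_cov_nonzero: "p \<in> pairs \<Longrightarrow> s \<noteq> 0 \<Longrightarrow> pair_cov s p \<noteq> 0"
  using pair_axis_cov_not_collinear[of p s 0] by simp

lemma axis_cov_nonzero: "axis_cov i \<noteq> 0"
  using c_nonzero c_add_nonzero by (auto simp: axis_cov_def axis_eq_0_iff)

lemma B_system_collinearD:
  assumes "\<alpha> \<in> B_system c\<^sub>0 c" "\<beta> \<in> B_system c\<^sub>0 c" "\<alpha> = t *s \<beta>"
  shows "\<alpha> = \<beta>"
proof -
  have mem: "(\<exists>s p. (s = 1 \<or> s = - 1) \<and> p \<in> pairs \<and> \<gamma> = pair_cov s p) \<or> (\<exists>i. \<gamma> = axis_cov i)"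
    if "\<gamma> \<in> B_system c\<^sub>0 c" for \<gamma>
    using that unfolding B_system_eq by blast
  \<comment> \<open>Members are nonzero, so the relation can be inverted. This handles an axis
    covector that is a multiple of a pair covector, as non-collinearity was shown in the other
    direction.\<close>
  have "t \<noteq> 0"
    using assms(1,3) mem[OF assms(1)] pair_cov_nonzero axis_cov_nonzero by force
  then have sym: "\<beta> = inverse t *s \<alpha>"
    by (simp add: assms(3))
  have signs: "s \<noteq> 0" if "s = 1 \<or> s = - 1" for s :: complex
    using that by auto
  from mem[OF assms(1)] show ?thesis
  proof (elim disjE[of "\<exists>s p. _ s p"] exE conjE)
    fix s p assume \<alpha>: "s = 1 \<or> s = - 1" "p \<in> pairs" "\<alpha> = pair_cov s p"
    from mem[OF assms(2)] show ?thesis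
    proof (elim disjE[of "\<exists>s p. _ s p"] exE conjE)
      fix s' q assume \<beta>: "s' = 1 \<or> s' = - 1" "q \<in> pairs" "\<beta> = pair_cov s' q"
      have "pair_cov s p = t *s pair_cov s' q"
        using assms(3) \<alpha>(3) \<beta>(3) by simp
      from pair_cov_collinearD[OF this \<alpha>(2) \<beta>(2) signs[OF \<alpha>(1)] signs[OF \<beta>(1)]]
      show ?thesis using \<alpha>(3) \<beta>(3) by simp
    next
      fix i assume "\<beta> = axis_cov i"
      then show ?thesis
        using pair_axis_cov_not_collinear[OF \<alpha>(2) signs[OF \<alpha>(1)]] assms(3) \<alpha>(3) by simp
    qed
  next
    fix i assume \<alpha>: "\<alpha> = axis_cov i"
    from mem[OF assms(2)] show ?thesis
    proof (elim disjE[of "\<exists>s p. _ s p"] exE conjE)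
      fix s' q assume "s' = 1 \<or> s' = - 1" "q \<in> pairs" "\<beta> = pair_cov s' q"
      then show ?thesis
        using pair_axis_cov_not_collinear[OF _ signs] sym \<alpha> by blast
    next
      fix j assume "\<beta> = axis_cov j"
      then show ?thesis
        using axis_cov_collinearD[of i t j] assms(3) \<alpha> by simp
    qed
  qed
qed

section \<open>Sums over the system\<close>

lemma finite_B_system: "finite (B_system c\<^sub>0 c)"
  unfolding B_system_eq by simp

lemma inj_pair_cov: "s \<noteq> 0 \<Longrightarrow> inj_on (pair_cov s) pairs"
  by (rule inj_onI) (metis pair_cov_collinearD(1) vec.scale_one)

lemma inj_axis_cov: "inj axis_cov"
  by (rule injI) (metis axis_cov_collinearD vec.scale_one)

text \<open>The three families are injectively parametrised, and they are disjoint by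
  non-collinearity, so a sum over the set becomes sums over the parameters.\<close>

lemma sum_B_system:
  "(\<Sum>\<beta>\<in>B_system c\<^sub>0 c. f \<beta>)
     = (\<Sum>p\<in>pairs. f (pair_cov 1 p) + f (pair_cov (- 1) p)) + (\<Sum>i\<in>UNIV. f (axis_cov i))"
proof -
  have 1: "pair_cov 1 ` pairs \<inter> pair_cov (- 1) ` pairs = {}"
  proof (rule ccontr)
    assume "\<not> ?thesis"
    then obtain p q where "p \<in> pairs" "q \<in> pairs" "pair_cov 1 p = pair_cov (- 1) q"
      by blast
    then show False
      using pair_cov_collinearD(2)[of 1 p 1 "- 1" q] by simp
  qed
  have 2: "(pair_cov 1 ` pairs \<union> pair_cov (- 1) ` pairs) \<inter> range axis_cov = {}"
  proof (rule ccontr)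
    assume "\<not> ?thesis"
    then obtain p i where "p \<in> pairs" "pair_cov 1 p = axis_cov i \<or> pair_cov (- 1) p = axis_cov i"
      by blast
    then show False
      using pair_axis_cov_not_collinear[of p 1 1 i] pair_axis_cov_not_collinear[of p "- 1" 1 i]
      by simp
  qed
  show ?thesis
    unfolding B_system_eq sum.distrib
    by (subst sum.union_disjoint[OF _ _ 2], simp, simp, subst sum.union_disjoint[OF _ _ 1])
      (simp_all add: sum.reindex inj_pair_cov inj_axis_cov)
qed

lemma sum_ordered_pairs:
  fixes h :: "'n \<Rightarrow> 'n \<Rightarrow> 'b::comm_monoid_add"
  shows "(\<Sum>(k, l)\<in>pairs. h k l + h l k) = (\<Sum>k\<in>UNIV. \<Sum>l\<in>UNIV - {k}. h k l)"
proof -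
  have "(\<Sum>k\<in>UNIV. \<Sum>l\<in>UNIV - {k}. h k l) = (\<Sum>(k, l)\<in>(SIGMA k:UNIV. UNIV - {k}). h k l)"
    by (rule sum.Sigma) auto
  also have "(SIGMA k:UNIV. UNIV - {k}) = pairs \<union> prod.swap ` pairs"
    by (auto simp: image_def)
  also have "(\<Sum>(k, l)\<in>pairs \<union> prod.swap ` pairs. h k l)
      = (\<Sum>(k, l)\<in>pairs. h k l) + (\<Sum>(k, l)\<in>prod.swap ` pairs. h k l)"
    by (rule sum.union_disjoint) auto
  also have "(\<Sum>(k, l)\<in>prod.swap ` pairs. h k l) = (\<Sum>(k, l)\<in>pairs. h l k)"
    by (subst sum.reindex) (auto simp: case_prod_unfold intro: inj_onI)
  finally show ?thesis
    by (simp add: sum.distrib case_prod_unfold)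
qed

lemma card_B_system: "card (B_system c\<^sub>0 c) = CARD('n)\<^sup>2"
proof -
  have "card (B_system c\<^sub>0 c) = (\<Sum>p\<in>pairs. 1 + 1) + CARD('n)"
    using sum_B_system[of "\<lambda>_. 1 :: nat"] by simp
  also have "(\<Sum>p\<in>pairs. 1 + 1 :: nat) = CARD('n) * (CARD('n) - 1)"
    using sum_ordered_pairs[of "\<lambda>_ _. 1 :: nat"] by (simp add: case_prod_unfold card_Diff_singleton)
  finally show ?thesis
    by (simp add: power2_eq_square algebra_simps)
qed

text \<open>For \<open>q\<close> homogeneous of degree one, q(\<beta>) \<beta>_i is quadratic in the
  normalising root, so the root appears only squared and its branch is irrelevant. Suitable choices
  of \<open>q\<close> give the canonical form, the sums in the \<or>-conditions and the right-hand
  side of the differential system.\<close>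

lemma sum_B_system_component:
  assumes q: "\<And>r v. r \<noteq> 0 \<Longrightarrow> q (r *s v) = r * q v"
  shows "(\<Sum>\<beta>\<in>B_system c\<^sub>0 c. q \<beta> * \<beta> $ i)
    = (\<Sum>l\<in>UNIV - {i}. c i * c l * (q (axis i 1 + axis l 1) + q (axis i 1 - axis l 1)))
      + 2 * c i * (c i + c\<^sub>0) * q (axis i 1)"
proof -
  \<comment> \<open>\<open>h k l\<close> is the contribution of both signs of the pair as seen from
    its member \<open>k\<close>; only the row k = i survives.\<close>
  define h where "h k l = (if k = i then
      c k * c l * (q (axis k 1 + axis l 1) + q (axis k 1 - axis l 1)) else 0)" for k l
  \<comment> \<open>If \<open>i\<close> is the second index of the pair, the i-th coordinate of e_k
    - e_l is negative; oddness of \<open>q\<close> absorbs this sign by reversing the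
    difference.\<close>
  have neg: "q (- v) = - q v" for v
    using q[of "- 1" v] by (simp add: vector_smult_lneg)
  have sq: "q (csqrt a *s v) * (csqrt a *s v) $ i = a * (q v * v $ i)" if "a \<noteq> 0" for a v
  proof -
    have "q (csqrt a *s v) * (csqrt a *s v) $ i = (csqrt a)\<^sup>2 * (q v * v $ i)"
      using that by (simp add: q power2_eq_square)
    then show ?thesis by simp
  qed
  have "q (pair_cov 1 (k, l)) * pair_cov 1 (k, l) $ i
      + q (pair_cov (- 1) (k, l)) * pair_cov (- 1) (k, l) $ i = h k l + h l k" for k l
  proof -
    have "q (axis l 1 - axis k 1) = - q (axis k 1 - axis l 1)"
      using neg[of "axis k 1 - axis l 1"] by simp
    moreover have "q (axis l 1 + axis k 1) = q (axis k 1 + axis l 1)"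
      by (simp add: add.commute)
    ultimately show ?thesis
      unfolding pair_cov_def h_def fst_conv snd_conv
      by (subst (1 2) sq) (auto simp: c_nonzero axis_def vector_smult_lneg algebra_simps)
  qed
  then have "(\<Sum>p\<in>pairs. q (pair_cov 1 p) * pair_cov 1 p $ i
      + q (pair_cov (- 1) p) * pair_cov (- 1) p $ i) = (\<Sum>(k, l)\<in>pairs. h k l + h l k)"
    by (intro sum.cong) auto
  also have "\<dots> = (\<Sum>k\<in>UNIV. \<Sum>l\<in>UNIV - {k}. h k l)"
    by (rule sum_ordered_pairs)
  also have "\<dots> = (\<Sum>k\<in>UNIV. if k = i then \<Sum>l\<in>UNIV - {i}. h i l else 0)"
    by (intro sum.cong) (auto simp: h_def)
  also have "\<dots> = (\<Sum>l\<in>UNIV - {i}. c i * c l * (q (axis i 1 + axis l 1) + q (axis i 1 - axis l 1)))"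
    by (simp add: h_def)
  finally have pairs: "(\<Sum>p\<in>pairs. q (pair_cov 1 p) * pair_cov 1 p $ i
      + q (pair_cov (- 1) p) * pair_cov (- 1) p $ i) = \<dots>" .
  have "(\<Sum>k\<in>UNIV. q (axis_cov k) * axis_cov k $ i)
      = (\<Sum>k\<in>UNIV. if k = i then 2 * c i * (c i + c\<^sub>0) * q (axis i 1) else 0)"
    unfolding axis_cov_def
    by (intro sum.cong refl, subst sq) (auto simp: c_nonzero c_add_nonzero axis_def)
  then show ?thesis
    unfolding sum_B_system by (simp add: pairs)
qed

end

section \<open>The canonical form and the \<open>\<or>\<close>-conditions\<close>

lemma ev_add: "ev (u + v) x = ev u x + ev v x"
  by (simp add: ev_def sum.distrib algebra_simps)

lemma ev_diff: "ev (u - v) x = ev u x - ev v x"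
  by (simp add: ev_def sum_subtractf algebra_simps)

lemma ev_scale: "ev (r *s v) x = r * ev v x"
  by (simp add: ev_def sum_distrib_left mult_ac)

lemma ev_axis: "ev (axis i a) x = a * x $ i"
proof -
  have "ev (axis i a) x = (\<Sum>j\<in>UNIV. if j = i then a * x $ i else 0)"
    unfolding ev_def by (intro sum.cong) (auto simp: axis_def)
  then show ?thesis by simp
qed

lemma subspace_mem_iff_add:
  assumes "vec.subspace P" "u + v \<in> P"
  shows "u \<in> P \<longleftrightarrow> v \<in> P"
  using vec.subspace_diff[OF assms, of u] vec.subspace_diff[OF assms, of v] by auto

lemma subspace_mem_iff_diff:
  assumes "vec.subspace P" "u - v \<in> P"
  shows "u \<in> P \<longleftrightarrow> v \<in> P"
  using vec.subspace_diff[OF assms(1) _ assms(2), of u] vec.subspace_add[OF assms, of v] by auto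

lemma subspace_scale_mem_iff:
  assumes "vec.subspace P" "r \<noteq> 0"
  shows "r *s v \<in> P \<longleftrightarrow> v \<in> (P :: (complex ^ 'n) set)"
  using vec.subspace_scale[OF assms(1), of v r] vec.subspace_scale[OF assms(1), of "r *s v" "inverse r"]
    assms(2) by auto

context B_parameters
begin

text \<open>The form is diagonal: the two signs of a pair cancel the cross terms, since (v_i + v_l)
  + (v_i - v_l) = 2 v_i, and the weights c_l for l \<noteq> i together with c_i + c_0 add up to
  \<open>\<sigma>\<close>.\<close>

lemma canonical_form_B_system:
  "canonical_form (B_system c\<^sub>0 c) v y = (\<Sum>i\<in>UNIV. 2 * \<sigma> * c i * v $ i * y $ i)"
proof -
  have comp: "(\<Sum>\<beta>\<in>B_system c\<^sub>0 c. ev \<beta> v * \<beta> $ i) = 2 * \<sigma> * c i * v $ i" for i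
  proof -
    have "(\<Sum>\<beta>\<in>B_system c\<^sub>0 c. ev \<beta> v * \<beta> $ i)
        = (\<Sum>l\<in>UNIV - {i}. 2 * c i * v $ i * c l) + 2 * c i * (c i + c\<^sub>0) * v $ i"
      by (subst sum_B_system_component) (simp_all add: ev_add ev_diff ev_scale ev_axis mult_ac)
    also have "\<dots> = 2 * c i * v $ i * ((\<Sum>l\<in>UNIV - {i}. c l) + c i + c\<^sub>0)"
      by (simp add: sum_distrib_left algebra_simps)
    also have "(\<Sum>l\<in>UNIV - {i}. c l) + c i + c\<^sub>0 = \<sigma>"
      by (simp add: \<sigma>_def sum.remove[of UNIV i] algebra_simps)
    finally show ?thesis by (simp add: mult_ac)
  qed
  have "canonical_form (B_system c\<^sub>0 c) v y = (\<Sum>\<beta>\<in>B_system c\<^sub>0 c. \<Sum>i\<in>UNIV. ev \<beta> v * \<beta> $ i * y $ i)"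
    by (simp add: canonical_form_def ev_def[of _ y] sum_distrib_left mult_ac)
  also have "\<dots> = (\<Sum>i\<in>UNIV. (\<Sum>\<beta>\<in>B_system c\<^sub>0 c. ev \<beta> v * \<beta> $ i) * y $ i)"
    by (subst sum.swap) (simp add: sum_distrib_right)
  finally show ?thesis by (simp add: comp)
qed

lemma dual_vec_B_system: "dual_vec (B_system c\<^sub>0 c) \<alpha> = (\<chi> i. \<alpha> $ i / (2 * \<sigma> * c i))"
  unfolding dual_vec_def
proof (rule the_equality)
  show "\<forall>x. canonical_form (B_system c\<^sub>0 c) (\<chi> i. \<alpha> $ i / (2 * \<sigma> * c i)) x = ev \<alpha> x"
    using sigma_neq_0 c_nonzero by (simp add: canonical_form_B_system ev_def)
next
  fix v assume v: "\<forall>x. canonical_form (B_system c\<^sub>0 c) v x = ev \<alpha> x"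
  have "2 * \<sigma> * c i * v $ i = \<alpha> $ i" for i
  proof -
    have "canonical_form (B_system c\<^sub>0 c) v (axis i 1) = 2 * \<sigma> * c i * v $ i"
      unfolding canonical_form_B_system by (subst sum.remove[of _ i]) (auto simp: axis_def)
    moreover have "ev \<alpha> (axis i 1) = \<alpha> $ i"
      unfolding ev_def by (subst sum.remove[of _ i]) (auto simp: axis_def)
    ultimately show ?thesis using v by metis
  qed
  then show "v = (\<chi> i. \<alpha> $ i / (2 * \<sigma> * c i))"
    using sigma_neq_0 c_nonzero by (simp add: vec_eq_iff field_simps)
qed

lemma nondegenerate_B_system: "nondegenerate_form (canonical_form (B_system c\<^sub>0 c))"
  unfolding nondegenerate_form_def
proof (intro allI impI)
  fix x assume x: "\<forall>y. canonical_form (B_system c\<^sub>0 c) x y = 0"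
  have "x $ i = 0" for i
  proof -
    have "canonical_form (B_system c\<^sub>0 c) x (axis i 1) = 2 * \<sigma> * c i * x $ i"
      unfolding canonical_form_B_system by (subst sum.remove[of _ i]) (auto simp: axis_def)
    then show ?thesis using x sigma_neq_0 c_nonzero by simp
  qed
  then show "x = 0" by (simp add: vec_eq_iff)
qed

lemma span_B_system: "vec.span (B_system c\<^sub>0 c) = UNIV"
proof -
  have "axis i 1 \<in> vec.span (B_system c\<^sub>0 c)" for i
  proof -
    have "axis_cov i \<in> vec.span (B_system c\<^sub>0 c)"
      by (rule vec.span_base) (auto simp: B_system_eq)
    then have "inverse (csqrt (2 * c i * (c i + c\<^sub>0))) *s axis_cov i \<in> vec.span (B_system c\<^sub>0 c)"
      by (rule vec.span_scale)
    then show ?thesis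
      using c_nonzero c_add_nonzero by (simp add: axis_cov_def)
  qed
  then have "(\<Sum>i\<in>UNIV. x $ i *s axis i 1) \<in> vec.span (B_system c\<^sub>0 c)" for x
    by (intro vec.span_sum vec.span_scale)
  then show ?thesis
    by (auto simp: basis_expansion)
qed

text \<open>This is the sum of the \<or>-condition with each \<beta>^\<or> replaced by \<beta>.
  Passage to dual vectors divides coordinate \<open>i\<close> by 2 \<sigma> c_i, so the condition
  says that this covector is proportional to \<alpha>.\<close>

definition vee_sum :: "(complex, 'n) vec set \<Rightarrow> (complex, 'n) vec \<Rightarrow> 'n \<Rightarrow> complex" where
  "vee_sum P a i = (\<Sum>\<beta>\<in>P \<inter> B_system c\<^sub>0 c. ev \<beta> a * \<beta> $ i)"

text \<open>Membership in a subspace is unchanged by nonzero scaling, so evaluation cut off by the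
  indicator of \<open>P\<close> is still homogeneous of degree one and the general coordinate
  formula applies.\<close>

lemma vee_sum_eq:
  assumes P: "vec.subspace P"
  shows "vee_sum P a i = (\<Sum>l\<in>UNIV - {i}. c i * c l *
      (of_bool (axis i 1 + axis l 1 \<in> P) * (a $ i + a $ l)
        + of_bool (axis i 1 - axis l 1 \<in> P) * (a $ i - a $ l)))
      + 2 * c i * (c i + c\<^sub>0) * (of_bool (axis i 1 \<in> P) * a $ i)"
proof -
  have "vee_sum P a i = (\<Sum>\<beta>\<in>B_system c\<^sub>0 c. (of_bool (\<beta> \<in> P) * ev \<beta> a) * \<beta> $ i)"
    unfolding vee_sum_def by (rule sum.mono_neutral_cong_left) (auto simp: finite_B_system)
  then show ?thesis
    by (subst (asm) sum_B_system_component)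
      (simp_all add: subspace_scale_mem_iff[OF P] ev_add ev_diff ev_scale ev_axis)
qed

text \<open>Since e_k lies in \<open>P\<close>, the covectors e_i + e_k and e_i - e_k lie in
  \<open>P\<close> together or not at all, and their contributions a_k and - a_k cancel.\<close>

lemma vee_sum_axis:
  assumes P: "vec.subspace P" "axis k 1 \<in> P"
    and a: "\<And>i. i \<noteq> k \<Longrightarrow> a $ i = 0" and "i \<noteq> k"
  shows "vee_sum P a i = 0"
proof -
  have "axis i 1 + axis k 1 \<in> P \<longleftrightarrow> axis i 1 \<in> P" "axis i 1 - axis k 1 \<in> P \<longleftrightarrow> axis i 1 \<in> P"
    using subspace_mem_iff_diff[OF P(1), of "axis i 1 + axis k 1" "axis i 1"]
      subspace_mem_iff_diff[OF P(1), of "axis i 1" "axis i 1 - axis k 1"] P(2) by simp_all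
  then have zero: "of_bool (axis i 1 + axis l 1 \<in> P) * (a $ i + a $ l)
        + of_bool (axis i 1 - axis l 1 \<in> P) * (a $ i - a $ l) = 0" for l
    using a[OF \<open>i \<noteq> k\<close>] a[of l] by (cases "l = k") simp_all
  show ?thesis
    unfolding vee_sum_eq[OF P(1)] zero by (simp add: a[OF \<open>i \<noteq> k\<close>])
qed

text \<open>Modulo \<open>P\<close> the covectors e_k and - s e_l agree, so membership of e_k + e_m
  and e_k - e_m is that of e_l + e_m and e_l - e_m up to order. This cancels the coordinates off
  \<open>k\<close> and \<open>l\<close> and makes the other two proportional to 1 and
  \<open>s\<close>.\<close>

lemma vee_sum_pair:
  assumes P: "vec.subspace P" and kl: "k \<noteq> l" and s: "s = 1 \<or> s = - 1"
    and u: "axis k 1 + s *s axis l 1 \<in> P"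
    and a: "a $ k = t / c k" "a $ l = s * t / c l" "\<And>i. i \<noteq> k \<Longrightarrow> i \<noteq> l \<Longrightarrow> a $ i = 0"
  shows "\<exists>w. \<forall>i. vee_sum P a i = w * (axis k 1 + s *s axis l 1) $ i"
proof -
  define p where "p v = (of_bool (v \<in> P) :: complex)" for v
  have minus: "- v \<in> P \<longleftrightarrow> v \<in> P" for v
    using subspace_scale_mem_iff[OF P, of "- 1" v] by simp
  have mem: "axis k 1 + m \<in> P \<longleftrightarrow> axis l 1 - s *s m \<in> P" for m
    using s subspace_mem_iff_add[OF P, of "axis k 1 + m" "axis l 1 - s *s m"]
      subspace_mem_iff_diff[OF P, of "axis k 1 + m" "axis l 1 - s *s m"] u
    by (auto simp: vector_smult_lneg)
  have pk: "p (axis k 1 + axis m 1) = p (axis l 1 - s *s axis m 1)"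
      "p (axis k 1 - axis m 1) = p (axis l 1 + s *s axis m 1)" for m
    using mem[of "axis m 1"] mem[of "- axis m 1"] by (simp_all add: p_def)
  have pm: "p (axis k 1 + axis m 1) + p (axis k 1 - axis m 1)
      = p (axis l 1 + axis m 1) + p (axis l 1 - axis m 1)" for m
    using s by (auto simp: pk vector_smult_lneg)
  have p_sym: "p (axis i 1 - axis j 1) = p (axis j 1 - axis i 1)" for i j
    using minus[of "axis i 1 - axis j 1"] by (simp add: p_def)
  have p_axis: "p (axis k 1) = p (axis l 1)"
    using mem[of 0] by (simp add: p_def)
  \<comment> \<open>The choice m = - s e_l in \<open>mem\<close> makes the other covector 2
    e_l.\<close>
  have p_pair: "p (axis k 1 - s *s axis l 1) = p (axis l 1)"
  proof -
    have "axis l 1 - s *s (- s *s axis l 1) = 2 *s axis l (1 :: complex)"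
        "axis k 1 + - s *s axis l 1 = axis k 1 - s *s axis l 1"
      using s by (auto simp: vec_eq_iff)
    then have "axis k 1 - s *s axis l 1 \<in> P \<longleftrightarrow> 2 *s axis l 1 \<in> P"
      using mem[of "- s *s axis l 1"] by metis
    then show ?thesis
      using subspace_scale_mem_iff[OF P, of 2 "axis l 1"] by (simp add: p_def)
  qed
  \<comment> \<open>\<open>N\<close> collects the indices other than \<open>k\<close> and
    \<open>l\<close>; by \<open>pm\<close> it is the same seen from \<open>k\<close> as from
    \<open>l\<close>. The resulting \<open>w\<close> is symmetric in \<open>k\<close> and
    \<open>l\<close>, which is why coordinate \<open>l\<close> comes out as s w.\<close>
  define N where "N = (\<Sum>m\<in>UNIV - {k, l}. c m * (p (axis l 1 + axis m 1) + p (axis l 1 - axis m 1)))"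
  define w where "w = t * (N + (c k + c l) + p (axis l 1) * (c k + c l + 2 * c\<^sub>0))"
  note eq = vee_sum_eq[OF P, folded p_def]
  have off: "vee_sum P a i = 0" if i: "i \<noteq> k" "i \<noteq> l" for i
  proof -
    have "vee_sum P a i = (\<Sum>m\<in>{k, l}. c i * c m *
      (p (axis i 1 + axis m 1) * (a $ i + a $ m) + p (axis i 1 - axis m 1) * (a $ i - a $ m)))"
      unfolding eq using i a(3) by (simp, intro sum.mono_neutral_right) auto
    also have "\<dots> = c i * t * (p (axis k 1 + axis i 1) - p (axis k 1 - axis i 1)
        + s * (p (axis l 1 + axis i 1) - p (axis l 1 - axis i 1)))"
      using kl i a c_nonzero
      by (simp add: p_sym[of i k] p_sym[of i l] add.commute[of "axis i 1"])
        (simp add: algebra_simps)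
    also have "\<dots> = 0"
      \<comment> \<open>By \<open>pk\<close>, the difference of the two indicators at
        \<open>k\<close> is - s times the one at \<open>l\<close>.\<close>
      using s by (auto simp: pk vector_smult_lneg)
    finally show ?thesis .
  qed
  have "vee_sum P a k = w"
  proof -
    have "vee_sum P a k = (\<Sum>m\<in>UNIV - {k, l}. c k * c m *
      (p (axis k 1 + axis m 1) * (a $ k + a $ m) + p (axis k 1 - axis m 1) * (a $ k - a $ m)))
       + c k * c l * (p (axis k 1 + axis l 1) * (a $ k + a $ l) + p (axis k 1 - axis l 1) * (a $ k - a $ l))
       + 2 * c k * (c k + c\<^sub>0) * (p (axis k 1) * a $ k)"
      unfolding eq using kl by (subst sum.remove[of _ l]) (auto simp: insert_commute Diff_insert2[symmetric])
    also have "(\<Sum>m\<in>UNIV - {k, l}. c k * c m *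
      (p (axis k 1 + axis m 1) * (a $ k + a $ m) + p (axis k 1 - axis m 1) * (a $ k - a $ m))) = t * N"
      unfolding N_def sum_distrib_left
    proof (intro sum.cong refl)
      fix m assume "m \<in> UNIV - {k, l}"
      then have "a $ m = 0" using a(3) by simp
      then show "c k * c m * (p (axis k 1 + axis m 1) * (a $ k + a $ m) + p (axis k 1 - axis m 1) * (a $ k - a $ m))
          = t * (c m * (p (axis l 1 + axis m 1) + p (axis l 1 - axis m 1)))"
        unfolding a(1) pm[symmetric] using c_nonzero[of k]
        by (simp add: distrib_left mult_ac)
    qed
    also have "c k * c l * (p (axis k 1 + axis l 1) * (a $ k + a $ l) + p (axis k 1 - axis l 1) * (a $ k - a $ l))
       = t * ((c k + c l) + p (axis l 1) * (c l - c k))"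
      using s u p_pair c_nonzero by (auto simp: a p_def vector_smult_lneg field_simps)
    also have "2 * c k * (c k + c\<^sub>0) * (p (axis k 1) * a $ k) = 2 * t * (c k + c\<^sub>0) * p (axis l 1)"
      using c_nonzero by (simp add: a p_axis)
    finally show ?thesis
      by (simp add: w_def algebra_simps)
  qed
  moreover have "vee_sum P a l = s * w"
  proof -
    have "vee_sum P a l = (\<Sum>m\<in>UNIV - {k, l}. c l * c m *
      (p (axis l 1 + axis m 1) * (a $ l + a $ m) + p (axis l 1 - axis m 1) * (a $ l - a $ m)))
       + c l * c k * (p (axis l 1 + axis k 1) * (a $ l + a $ k) + p (axis l 1 - axis k 1) * (a $ l - a $ k))
       + 2 * c l * (c l + c\<^sub>0) * (p (axis l 1) * a $ l)"
      unfolding eq using kl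
      by (subst sum.remove[of _ k]) (auto simp: Diff_insert2[symmetric] insert_commute[of l k])
    also have "(\<Sum>m\<in>UNIV - {k, l}. c l * c m *
      (p (axis l 1 + axis m 1) * (a $ l + a $ m) + p (axis l 1 - axis m 1) * (a $ l - a $ m))) = s * t * N"
      unfolding N_def sum_distrib_left
    proof (intro sum.cong refl)
      fix m assume "m \<in> UNIV - {k, l}"
      then have "a $ m = 0" using a(3) by simp
      then show "c l * c m * (p (axis l 1 + axis m 1) * (a $ l + a $ m) + p (axis l 1 - axis m 1) * (a $ l - a $ m))
          = s * t * (c m * (p (axis l 1 + axis m 1) + p (axis l 1 - axis m 1)))"
        unfolding a(2) using c_nonzero[of l]
        by (simp add: distrib_left mult_ac)
    qed
    also have "c l * c k * (p (axis l 1 + axis k 1) * (a $ l + a $ k) + p (axis l 1 - axis k 1) * (a $ l - a $ k))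
       = s * t * ((c k + c l) + p (axis l 1) * (c k - c l))"
      using s u p_pair p_sym[of l k] c_nonzero
      by (auto simp: a p_def vector_smult_lneg add.commute[of "axis l 1"] field_simps)
    also have "2 * c l * (c l + c\<^sub>0) * (p (axis l 1) * a $ l) = 2 * s * t * (c l + c\<^sub>0) * p (axis l 1)"
      using c_nonzero by (simp add: a)
    finally show ?thesis
      by (simp add: w_def algebra_simps)
  qed
  ultimately have "vee_sum P a i = w * (axis k 1 + s *s axis l 1) $ i" for i
    using off[of i] kl by (cases "i = k"; cases "i = l") (auto simp: axis_def)
  then show ?thesis by blast
qed

lemma vee_system_B_system: "vee_system (B_system c\<^sub>0 c)"
  unfolding vee_system_def
proof (intro conjI ballI impI allI)
  fix \<alpha> \<beta> assume ab: "\<alpha> \<in> B_system c\<^sub>0 c" "\<beta> \<in> B_system c\<^sub>0 c" "\<alpha> \<noteq> \<beta>"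
  \<comment> \<open>A zero member would be 0 times the other member and hence equal to it.\<close>
  have "\<beta> \<noteq> 0"
    using B_system_collinearD[OF ab(2,1), of 0] ab(3) by auto
  moreover have "\<alpha> \<notin> vec.span {\<beta>}"
    using B_system_collinearD[OF ab(1,2)] ab(3) by (auto simp: vec.span_singleton)
  ultimately show "vec.independent {\<alpha>, \<beta>}"
    using ab(3) by (simp add: vec.independent_insert)
next
  fix \<alpha> P
  assume \<alpha>: "\<alpha> \<in> B_system c\<^sub>0 c" and "vec.subspace P \<and> vec.dim P = 2 \<and> \<alpha> \<in> P"
  then have P: "vec.subspace P" "\<alpha> \<in> P" by auto
  define a where "a = dual_vec (B_system c\<^sub>0 c) \<alpha>"
  have a: "a $ i = \<alpha> $ i / (2 * \<sigma> * c i)" for i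
    by (simp add: a_def dual_vec_B_system)
  have "\<exists>\<nu>. \<forall>i. vee_sum P a i = \<nu> * \<alpha> $ i"
  proof -
    from \<alpha> consider p s where "p \<in> pairs" "s = 1 \<or> s = - 1" "\<alpha> = pair_cov s p" | i where "\<alpha> = axis_cov i"
      unfolding B_system_eq by blast
    then show ?thesis
    proof cases
      case 1
      obtain k l where p: "p = (k, l)" "k < l" using 1(1) by auto
      define r where "r = csqrt (c k * c l)"
      have r: "r \<noteq> 0" "\<alpha> = r *s (axis k 1 + s *s axis l 1)"
        using 1(3) p c_nonzero by (simp_all add: r_def pair_cov_def)
      have "\<exists>w. \<forall>i. vee_sum P a i = w * (axis k 1 + s *s axis l 1) $ i"
      \<comment> \<open>The normalisation \<open>r\<close> of \<alpha> and the factor 2 \<sigma> of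
        the form enter the dual vector only through this common scalar.\<close>
      proof (rule vee_sum_pair[where t = "r / (2 * \<sigma>)"])
        show "axis k 1 + s *s axis l 1 \<in> P"
          using P(2) subspace_scale_mem_iff[OF P(1) r(1)] unfolding r(2) by blast
        have "\<alpha> $ i = r * (of_bool (i = k) + s * of_bool (i = l))" for i
          by (simp add: r(2) axis_def distrib_left)
        then show "a $ k = r / (2 * \<sigma>) / c k" "a $ l = s * (r / (2 * \<sigma>)) / c l"
            "\<And>i. i \<noteq> k \<Longrightarrow> i \<noteq> l \<Longrightarrow> a $ i = 0"
          using p(2) by (auto simp: a)
      qed (use p(2) 1(2) P in auto)
      then obtain w where w: "\<And>i. vee_sum P a i = w * (axis k 1 + s *s axis l 1) $ i" by blast
      have "\<forall>i. vee_sum P a i = (w / r) * \<alpha> $ i"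
        unfolding w r(2) vector_smult_component[of r] using r(1) by simp
      then show ?thesis by blast
    next
      case (2 k)
      define r where "r = csqrt (2 * c k * (c k + c\<^sub>0))"
      have r: "r \<noteq> 0" "\<alpha> = r *s axis k 1"
        using 2 c_nonzero c_add_nonzero by (simp_all add: r_def axis_cov_def)
      have "vee_sum P a i = 0" if "i \<noteq> k" for i
      proof (rule vee_sum_axis[OF P(1) _ _ that])
        show "axis k 1 \<in> P"
          using P r subspace_scale_mem_iff[OF P(1) r(1)] by simp
      qed (simp add: a r(2) axis_def)
      then have "\<forall>i. vee_sum P a i = (vee_sum P a k / r) * \<alpha> $ i"
        using r by (auto simp: axis_def)
      then show ?thesis by blast
    qed
  qed
  then obtain \<nu> where \<nu>: "\<And>i. vee_sum P a i = \<nu> * \<alpha> $ i" by blast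
  have "(\<Sum>\<beta>\<in>P \<inter> B_system c\<^sub>0 c. ev \<beta> a *s dual_vec (B_system c\<^sub>0 c) \<beta>) $ i
      = vee_sum P a i / (2 * \<sigma> * c i)" for i
    by (simp add: vee_sum_def sum_component dual_vec_B_system sum_divide_distrib)
  then have "(\<Sum>\<beta>\<in>P \<inter> B_system c\<^sub>0 c. ev \<beta> a *s dual_vec (B_system c\<^sub>0 c) \<beta>) = \<nu> *s a"
    by (simp add: vec_eq_iff \<nu> a)
  then show "\<exists>\<nu>. (\<Sum>\<beta>\<in>P \<inter> B_system c\<^sub>0 c. ev \<beta> (dual_vec (B_system c\<^sub>0 c) \<alpha>) *s dual_vec (B_system c\<^sub>0 c) \<beta>)
      = \<nu> *s dual_vec (B_system c\<^sub>0 c) \<alpha>"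
    unfolding a_def by blast
qed (rule finite_B_system span_B_system nondegenerate_B_system)+

end

section \<open>The system in coordinates\<close>

text \<open>This is the contribution of one pair to coordinate \<open>i\<close> of the system,
  multiplied by x_i. Here a, b stand for c_i, c_l, the quotients by 2 s a and 2 s b are components
  of the field, \<open>s\<close> is \<open>\<sigma>\<close>, and \<open>m\<close> is the mixed
  second derivative. Over the common denominator x^2 - y^2 the claim is a polynomial
  identity.\<close>

lemma pair_term_identity:
  fixes a b s k x y u v g h :: complex
  assumes "x + y \<noteq> 0" "x - y \<noteq> 0" "s \<noteq> 0" "a \<noteq> 0" "b \<noteq> 0"
    and m: "(x\<^sup>2 - y\<^sup>2) * m = k / s * (a * x * h - b * y * g)"
  shows "k * (a * b * ((u + v) * (g / (2 * s * a) + h / (2 * s * b)) / (x + y)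
      + (u - v) * (g / (2 * s * a) - h / (2 * s * b)) / (x - y))) * x
    = v * x * m - u * y * m + k / s * u * g * b"
proof -
  define D where "D = x\<^sup>2 - y\<^sup>2"
  have D: "D = (x + y) * (x - y)"
    by (simp add: D_def power2_eq_square algebra_simps)
  then have "D \<noteq> 0"
    using assms(1,2) by simp
  have m': "m = k * (a * x * h - b * y * g) / (s * D)"
    using m \<open>D \<noteq> 0\<close> \<open>s \<noteq> 0\<close> unfolding D_def[symmetric] by (simp add: field_simps)
  have 1: "a * b * (g / (2 * s * a) + h / (2 * s * b)) = (b * g + a * h) / (2 * s)"
    using assms by (simp add: field_simps)
  have 2: "a * b * (g / (2 * s * a) - h / (2 * s * b)) = (b * g - a * h) / (2 * s)"
    using assms by (simp add: field_simps)
  have dist: "a * b * ((u + v) * p / (x + y) + (u - v) * r / (x - y))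
      = (u + v) * (a * b * p) / (x + y) + (u - v) * (a * b * r) / (x - y)" for p r
    by (simp add: distrib_left mult_ac)
  have frac: "p * (q / (2 * s)) / z + p' * (q' / (2 * s)) / w
      = (p * q * w + p' * q' * z) / (2 * s * (z * w))" if "z \<noteq> 0" "w \<noteq> 0" for p q p' q' z w
    using that \<open>s \<noteq> 0\<close> by (simp add: field_simps)
  have "a * b * ((u + v) * (g / (2 * s * a) + h / (2 * s * b)) / (x + y)
      + (u - v) * (g / (2 * s * a) - h / (2 * s * b)) / (x - y))
    = (u + v) * (a * b * (g / (2 * s * a) + h / (2 * s * b))) / (x + y)
      + (u - v) * (a * b * (g / (2 * s * a) - h / (2 * s * b))) / (x - y)"
    by (rule dist)
  also have "\<dots> = ((u + v) * (b * g + a * h) * (x - y) + (u - v) * (b * g - a * h) * (x + y)) / (2 * s * D)"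
    unfolding 1 2 D by (rule frac[OF assms(1,2)])
  finally have "k * (a * b * ((u + v) * (g / (2 * s * a) + h / (2 * s * b)) / (x + y)
      + (u - v) * (g / (2 * s * a) - h / (2 * s * b)) / (x - y))) * x
     = k * ((u + v) * (b * g + a * h) * (x - y) + (u - v) * (b * g - a * h) * (x + y)) * x / (2 * s * D)"
    by simp
  also have "\<dots> = v * x * m - u * y * m + k / s * u * g * b"
  proof -
    \<comment> \<open>After \<open>D\<close> is cleared, what remains is the polynomial identity in
      the premise, with p = a x h - b y g.\<close>
    have collect: "k * q * x / (2 * s * D) = v * x * (k * p / (s * D)) - u * y * (k * p / (s * D)) + k / s * u * g * b"
      if "q * x = 2 * ((v * x - u * y) * p + u * g * b * D)" for p q
    proof -
      define z where "z = (v * x - u * y) * p + u * g * b * D"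
      have "q * x = 2 * z" using that by (simp add: z_def)
      then have "k * q * x / (2 * s * D) = k * ((v * x - u * y) * p + u * g * b * D) / (s * D)"
        unfolding z_def[symmetric] by (simp add: mult.assoc)
      then show ?thesis
        using \<open>D \<noteq> 0\<close> \<open>s \<noteq> 0\<close> by (simp add: field_simps)
    qed
    show ?thesis
      unfolding m' by (rule collect) (simp add: D_def power2_eq_square algebra_simps)
  qed
  finally show ?thesis .
qed

context B_parameters
begin

lemma B_system_regularD:
  assumes "\<forall>\<alpha>\<in>B_system c\<^sub>0 c. ev \<alpha> x \<noteq> 0"
  shows "x $ i \<noteq> 0" "i \<noteq> j \<Longrightarrow> x $ i + x $ j \<noteq> 0" "i \<noteq> j \<Longrightarrow> x $ i - x $ j \<noteq> 0"
proof -
  have "ev (axis_cov i) x \<noteq> 0"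
    using assms by (auto simp: B_system_eq)
  then show "x $ i \<noteq> 0" by (simp add: axis_cov_def ev_scale ev_axis)
  have *: "x $ k + x $ l \<noteq> 0 \<and> x $ k - x $ l \<noteq> 0" if "k < l" for k l
  proof -
    have "ev (pair_cov 1 (k, l)) x \<noteq> 0" "ev (pair_cov (- 1) (k, l)) x \<noteq> 0"
      using assms that unfolding B_system_eq by blast+
    then show ?thesis
      unfolding pair_cov_def ev_scale ev_add ev_axis by auto
  qed
  show "i \<noteq> j \<Longrightarrow> x $ i + x $ j \<noteq> 0" "i \<noteq> j \<Longrightarrow> x $ i - x $ j \<noteq> 0"
    using *[of i j] *[of j i] by (auto simp: neq_iff add.commute)
qed

text \<open>
  On the gradient \<open>g\<close> and the Hessian \<open>h\<close> of a potential, the system amounts to the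
  Euler--Poisson--Darboux equations off the diagonal; homogeneity then accounts for the diagonal.
\<close>

lemma solves_system_B_system:
  assumes deriv: "\<And>\<xi> x i. has_dir_deriv (\<lambda>y. g y i) \<xi> x (\<Sum>j\<in>UNIV. \<xi> $ j * h x i j)"
    and mixed: "\<And>x i j. i \<noteq> j \<Longrightarrow>
      ((x $ i)\<^sup>2 - (x $ j)\<^sup>2) * h x i j = \<kappa> / \<sigma> * (c i * x $ i * g x j - c j * x $ j * g x i)"
    and euler: "\<And>x i. (\<Sum>j\<in>UNIV. x $ j * h x i j) = \<kappa> * g x i"
  shows "solves_system (B_system c\<^sub>0 c) \<kappa> (\<lambda>x. \<chi> i. g x i / (2 * \<sigma> * c i))"
  unfolding solves_system_def
proof (intro allI impI)
  fix \<xi> x i assume reg: "\<forall>\<alpha>\<in>B_system c\<^sub>0 c. ev \<alpha> x \<noteq> 0"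
  define \<psi> where "\<psi> = (\<lambda>x. \<chi> i. g x i / (2 * \<sigma> * c i))"
  define q where "q v = ev v \<xi> * ev v (\<psi> x) / ev v x" for v
  note R = B_system_regularD[OF reg]
  have sum_eq: "(\<Sum>\<alpha>\<in>B_system c\<^sub>0 c. q \<alpha> * \<alpha> $ i)
    = (\<Sum>l\<in>UNIV - {i}. c i * c l * (q (axis i 1 + axis l 1) + q (axis i 1 - axis l 1)))
      + 2 * c i * (c i + c\<^sub>0) * q (axis i 1)"
    by (rule sum_B_system_component) (simp add: q_def ev_scale)
  have pair_term: "\<kappa> * (c i * c l * (q (axis i 1 + axis l 1) + q (axis i 1 - axis l 1))) * x $ i
      = x $ i * (\<xi> $ l * h x i l) - \<xi> $ i * (x $ l * h x i l) + \<kappa> / \<sigma> * \<xi> $ i * g x i * c l"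
    if "l \<in> UNIV - {i}" for l
  proof -
    have "i \<noteq> l" using that by auto
    from pair_term_identity[OF R(2)[OF this] R(3)[OF this] sigma_neq_0 c_nonzero c_nonzero mixed[OF this],
        of "\<xi> $ i" "\<xi> $ l"]
    show ?thesis
      by (simp add: q_def \<psi>_def ev_add ev_diff ev_axis mult_ac)
  qed
  have axis_term: "\<kappa> * (2 * c i * (c i + c\<^sub>0) * q (axis i 1)) * x $ i = \<kappa> / \<sigma> * \<xi> $ i * g x i * (c i + c\<^sub>0)"
    using R(1)[of i] c_nonzero[of i] sigma_neq_0 by (simp add: q_def \<psi>_def ev_axis)
  have dist: "\<kappa> * (S + T) * x $ i = \<kappa> * S * x $ i + \<kappa> * T * x $ i" for S T
    by (simp add: algebra_simps)
  \<comment> \<open>The factor x_i, nonzero at a regular point, clears the last denominator. In the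
    sum the weights add up to \<open>\<sigma>\<close>, Euler's identity replaces the sum of x_l
    h_il, and the terms \<kappa> \<xi>_i g_i cancel, leaving x_i times the directional
    derivative.\<close>
  have "\<kappa> * (\<Sum>\<alpha>\<in>B_system c\<^sub>0 c. q \<alpha> * \<alpha> $ i) * x $ i
     = (\<Sum>l\<in>UNIV - {i}. \<kappa> * (c i * c l * (q (axis i 1 + axis l 1) + q (axis i 1 - axis l 1))) * x $ i)
       + \<kappa> / \<sigma> * \<xi> $ i * g x i * (c i + c\<^sub>0)"
    unfolding sum_eq dist axis_term by (simp only: sum_distrib_left sum_distrib_right)
  also have "\<dots> = x $ i * (\<Sum>l\<in>UNIV - {i}. \<xi> $ l * h x i l) - \<xi> $ i * (\<Sum>l\<in>UNIV - {i}. x $ l * h x i l)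
       + \<kappa> / \<sigma> * \<xi> $ i * g x i * ((\<Sum>l\<in>UNIV - {i}. c l) + c i + c\<^sub>0)"
    by (subst sum.cong[OF refl pair_term])
      (simp_all add: sum.distrib sum_subtractf sum_distrib_left sum_divide_distrib add_divide_distrib algebra_simps)
  also have "(\<Sum>l\<in>UNIV - {i}. c l) + c i + c\<^sub>0 = \<sigma>"
    by (simp add: \<sigma>_def sum.remove[of UNIV i] algebra_simps)
  also have "(\<Sum>l\<in>UNIV - {i}. x $ l * h x i l) = \<kappa> * g x i - x $ i * h x i i"
    using euler[of x i] by (simp add: sum.remove[of UNIV i] algebra_simps)
  also have "(\<Sum>l\<in>UNIV - {i}. \<xi> $ l * h x i l) = (\<Sum>l\<in>UNIV. \<xi> $ l * h x i l) - \<xi> $ i * h x i i"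
    by (simp add: sum.remove[of UNIV i] algebra_simps)
  also have "x $ i * ((\<Sum>l\<in>UNIV. \<xi> $ l * h x i l) - \<xi> $ i * h x i i)
      - \<xi> $ i * (\<kappa> * g x i - x $ i * h x i i) + \<kappa> / \<sigma> * \<xi> $ i * g x i * \<sigma>
    = (\<Sum>l\<in>UNIV. \<xi> $ l * h x i l) * x $ i"
    using sigma_neq_0 by (simp add: algebra_simps)
  finally have *: "\<kappa> * (\<Sum>\<alpha>\<in>B_system c\<^sub>0 c. q \<alpha> * \<alpha> $ i) = (\<Sum>l\<in>UNIV. \<xi> $ l * h x i l)"
    using R(1)[of i] by simp
  have "(\<kappa> *s (\<Sum>\<alpha>\<in>B_system c\<^sub>0 c. (ev \<alpha> \<xi> * ev \<alpha> (\<psi> x) / ev \<alpha> x) *s dual_vec (B_system c\<^sub>0 c) \<alpha>)) $ i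
    = \<kappa> * (\<Sum>\<alpha>\<in>B_system c\<^sub>0 c. q \<alpha> * \<alpha> $ i) / (2 * \<sigma> * c i)"
  proof -
    have "\<kappa> * (\<Sum>\<alpha>\<in>B_system c\<^sub>0 c. q \<alpha> * \<alpha> $ i) / (2 * \<sigma> * c i)
        = \<kappa> * (\<Sum>\<alpha>\<in>B_system c\<^sub>0 c. q \<alpha> * (\<alpha> $ i / (2 * \<sigma> * c i)))"
      by (simp flip: sum_divide_distrib)
    then show ?thesis
      by (simp only: q_def sum_component dual_vec_B_system vector_smult_component vec_lambda_beta)
  qed
  then have "(\<kappa> *s (\<Sum>\<alpha>\<in>B_system c\<^sub>0 c. (ev \<alpha> \<xi> * ev \<alpha> (\<psi> x) / ev \<alpha> x) *s dual_vec (B_system c\<^sub>0 c) \<alpha>)) $ i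
    = (\<Sum>l\<in>UNIV. \<xi> $ l * h x i l) / (2 * \<sigma> * c i)"
    unfolding * .
  moreover have "has_dir_deriv (\<lambda>y. \<psi> y $ i) \<xi> x ((\<Sum>l\<in>UNIV. \<xi> $ l * h x i l) / (2 * \<sigma> * c i))"
    using deriv[of i \<xi> x] unfolding has_dir_deriv_def \<psi>_def
    by (simp add: DERIV_cdivide)
  ultimately show "has_dir_deriv (\<lambda>y. (\<chi> i. g y i / (2 * \<sigma> * c i)) $ i) \<xi> x
      ((\<kappa> *s (\<Sum>\<alpha>\<in>B_system c\<^sub>0 c. (ev \<alpha> \<xi> * ev \<alpha> (\<chi> i. g x i / (2 * \<sigma> * c i)) / ev \<alpha> x)
         *s dual_vec (B_system c\<^sub>0 c) \<alpha>)) $ i)"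
    by (simp add: \<psi>_def)
qed

end

section \<open>The generating function of the potentials\<close>

text \<open>The formal binomial series of (1 - x^2 X)^l in X.\<close>

definition binomial_factor :: "complex \<Rightarrow> complex \<Rightarrow> complex fps" where
  "binomial_factor l x = Abs_fps (\<lambda>n. (l gchoose n) * (- x\<^sup>2) ^ n)"

text \<open>The logarithmic derivative of \<open>(1 - x\<^sup>2 X)\<^sup>l\<close> with respect to \<open>x\<close>.\<close>

definition log_factor :: "complex \<Rightarrow> complex \<Rightarrow> complex fps" where
  "log_factor l x = Abs_fps (\<lambda>n. if n = 0 then 0 else - 2 * l * x ^ (2 * n - 1))"

definition log_factor_deriv :: "complex \<Rightarrow> complex \<Rightarrow> complex fps" where
  "log_factor_deriv l x =
     Abs_fps (\<lambda>n. if n = 0 then 0 else - 2 * l * (of_nat (2 * n - 1) * x ^ (2 * n - 2)))"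

definition gen_fun :: "('n::finite \<Rightarrow> complex) \<Rightarrow> complex ^ 'n \<Rightarrow> complex fps" where
  "gen_fun l x = (\<Prod>j\<in>UNIV. binomial_factor (l j) (x $ j))"

text \<open>Differentiation in a parameter, coefficient by coefficient, as opposed to the formal
  derivative in X.\<close>

definition fps_deriv_at :: "(complex \<Rightarrow> complex fps) \<Rightarrow> complex fps \<Rightarrow> complex \<Rightarrow> bool" where
  "fps_deriv_at f f' t \<longleftrightarrow>
     (\<forall>n. ((\<lambda>s. fps_nth (f s) n) has_field_derivative fps_nth f' n) (at t))"

lemma fps_deriv_at_mult:
  assumes "fps_deriv_at f f' t" "fps_deriv_at g g' t"
  shows "fps_deriv_at (\<lambda>s. f s * g s) (f' * g t + f t * g') t"
  unfolding fps_deriv_at_def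
proof
  fix n
  have "((\<lambda>s. \<Sum>i=0..n. fps_nth (f s) i * fps_nth (g s) (n - i)) has_field_derivative
     (\<Sum>i=0..n. fps_nth f' i * fps_nth (g t) (n - i) + fps_nth (f t) i * fps_nth g' (n - i))) (at t)"
    using assms unfolding fps_deriv_at_def
    by (intro DERIV_sum) (auto intro!: derivative_eq_intros)
  then show "((\<lambda>s. fps_nth (f s * g s) n) has_field_derivative fps_nth (f' * g t + f t * g') n) (at t)"
    by (simp add: fps_mult_nth sum.distrib)
qed

text \<open>Logarithmic derivatives add under products; the derivative of each factor is given as
  the factor times \<open>e i\<close>.\<close>

lemma fps_deriv_at_prod:
  assumes "finite I" "\<And>i. i \<in> I \<Longrightarrow> fps_deriv_at (f i) (f i t * e i) t"
  shows "fps_deriv_at (\<lambda>s. \<Prod>i\<in>I. f i s) ((\<Prod>i\<in>I. f i t) * (\<Sum>i\<in>I. e i)) t"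
  using assms
proof (induction I rule: finite_induct)
  case empty
  then show ?case by (simp add: fps_deriv_at_def)
next
  case (insert i I)
  have "fps_deriv_at (\<lambda>s. f i s * (\<Prod>i\<in>I. f i s))
      (f i t * e i * (\<Prod>i\<in>I. f i t) + f i t * ((\<Prod>i\<in>I. f i t) * (\<Sum>i\<in>I. e i))) t"
    using insert by (intro fps_deriv_at_mult) auto
  then show ?case using insert.hyps by (simp add: algebra_simps)
qed

text \<open>The series 1 - u X is the denominator of a logarithmic derivative. Multiplying by it
  turns an identity of series into a relation between neighbouring coefficients, and it can be
  cancelled afterwards.\<close>

lemma fps_nth_mult_linear:
  "fps_nth (f * (1 - fps_const u * fps_X)) n = fps_nth f n - (if n = 0 then 0 else u * fps_nth f (n - 1))"
  for u :: complex
proof -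
  have "f * (1 - fps_const u * fps_X) = f - fps_const u * (f * fps_X)"
    by (simp only: right_diff_distrib mult_1_right mult.left_commute)
  then show ?thesis by simp
qed

lemma linear_fps_nonzero: "1 - fps_const (u :: complex) * fps_X \<noteq> 0"
proof
  assume "1 - fps_const u * fps_X = 0"
  then have "fps_nth (1 - fps_const u * fps_X) 0 = 0" by simp
  then show False by simp
qed

lemma log_factor_mult_linear:
  "log_factor l x * (1 - fps_const (x\<^sup>2) * fps_X) = fps_const (- 2 * l * x) * fps_X"
proof (rule fps_ext)
  fix n
  show "fps_nth (log_factor l x * (1 - fps_const (x\<^sup>2) * fps_X)) n = fps_nth (fps_const (- 2 * l * x) * fps_X) n"
    unfolding fps_nth_mult_linear
    by (cases n; cases "n - 1") (auto simp: log_factor_def power2_eq_square)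
qed

text \<open>Partial fractions: the denominators 1 - y^2 X and 1 - x^2 X differ by (x^2 - y^2) X, and
  the common factor X cancels.\<close>

lemma log_factor_mult:
  "fps_const (x\<^sup>2 - y\<^sup>2) * (log_factor l x * log_factor m y)
    = fps_const (2 * l * x) * log_factor m y - fps_const (2 * m * y) * log_factor l x"
proof -
  define A where "A u = 1 - fps_const (u\<^sup>2) * fps_X" for u :: complex
  have A: "log_factor l u * A u = - fps_const (2 * l * u) * fps_X" for l u
    using log_factor_mult_linear[of l u] by (simp add: A_def del: fps_const_neg flip: fps_const_neg)
  have "fps_X * (fps_const (x\<^sup>2 - y\<^sup>2) * (log_factor l x * log_factor m y))
     = (A y - A x) * (log_factor l x * log_factor m y)"
    by (simp add: A_def algebra_simps flip: fps_const_sub)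
  also have "\<dots> = log_factor l x * (log_factor m y * A y) - (log_factor l x * A x) * log_factor m y"
    by (simp add: algebra_simps)
  also have "\<dots> = fps_X * (fps_const (2 * l * x) * log_factor m y - fps_const (2 * m * y) * log_factor l x)"
    unfolding A by (simp add: algebra_simps del: fps_const_neg)
  finally show ?thesis by simp
qed

text \<open>The series \<open>d\<close> of coefficientwise derivatives satisfies d (1 - x^2 X) = - 2
  l x X (1 - x^2 X)^l by the recurrence of the binomial coefficients, and the linear factor is then
  cancelled.\<close>

lemma binomial_factor_deriv:
  "fps_deriv_at (\<lambda>t. binomial_factor l (x + t * \<xi>))
    (binomial_factor l x * (fps_const \<xi> * log_factor l x)) 0"
proof -
  define d where "d = Abs_fps (\<lambda>n. (l gchoose n) * (- 1) ^ n * (of_nat (2 * n) * x ^ (2 * n - 1)))"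
  have "d * (1 - fps_const (x\<^sup>2) * fps_X) = binomial_factor l x * (fps_const (- 2 * l * x) * fps_X)"
  proof (rule fps_ext)
    fix n
    have binom: "of_nat (Suc m) * (l gchoose Suc m) = (l - of_nat m) * (l gchoose m)" for m
      using gbinomial_absorb_comp[of l m] gbinomial_absorption[of m l] by simp
    show "fps_nth (d * (1 - fps_const (x\<^sup>2) * fps_X)) n
        = fps_nth (binomial_factor l x * (fps_const (- 2 * l * x) * fps_X)) n"
    proof (cases n)
      case 0
      then show ?thesis unfolding fps_nth_mult_linear by (simp add: d_def)
    next
      case (Suc m)
      have "fps_nth (d * (1 - fps_const (x\<^sup>2) * fps_X)) n
        = (- 1) ^ Suc m * 2 * (of_nat (Suc m) * (l gchoose Suc m)) * x ^ (2 * m + 1)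
          - (- 1) ^ m * 2 * (of_nat m * (l gchoose m)) * (x\<^sup>2 * x ^ (2 * m - 1))"
        unfolding fps_nth_mult_linear Suc by (simp add: d_def algebra_simps)
      \<comment> \<open>At m = 0 the exponent 2 m - 1 is truncated to 0, but the factor
        \<open>of_nat m\<close> vanishes.\<close>
      also have "of_nat m * (l gchoose m) * (x\<^sup>2 * x ^ (2 * m - 1)) = of_nat m * (l gchoose m) * x ^ (2 * m + 1)"
        by (cases m) (simp_all add: power2_eq_square)
      then have "(- 1) ^ m * 2 * (of_nat m * (l gchoose m)) * (x\<^sup>2 * x ^ (2 * m - 1))
          = (- 1) ^ m * 2 * (of_nat m * (l gchoose m)) * x ^ (2 * m + 1)"
        by (simp add: mult.assoc)
      also have "(- 1) ^ Suc m * 2 * (of_nat (Suc m) * (l gchoose Suc m)) * x ^ (2 * m + 1)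
            - (- 1) ^ m * 2 * (of_nat m * (l gchoose m)) * x ^ (2 * m + 1)
          = - 2 * l * x * ((l gchoose m) * ((- 1) ^ m * (x\<^sup>2) ^ m))"
        unfolding binom by (simp add: algebra_simps flip: power_mult)
      also have "(- 1) ^ m * (x\<^sup>2) ^ m = (- x\<^sup>2) ^ m"
        by (metis mult_minus1 power_mult_distrib)
      finally show ?thesis
        unfolding mult.left_commute[of "binomial_factor l x"] Suc
        by (simp add: binomial_factor_def)
    qed
  qed
  also have "\<dots> = binomial_factor l x * log_factor l x * (1 - fps_const (x\<^sup>2) * fps_X)"
    by (simp add: log_factor_mult_linear mult.assoc)
  finally have "d = binomial_factor l x * log_factor l x"
    using linear_fps_nonzero by simp
  then have d: "binomial_factor l x * (fps_const \<xi> * log_factor l x) = fps_const \<xi> * d"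
    by (simp add: mult_ac)
  show ?thesis
    unfolding d fps_deriv_at_def
  proof
    fix n
    have "((\<lambda>t. (l gchoose n) * (- 1) ^ n * (x + t * \<xi>) ^ (2 * n)) has_field_derivative
        (l gchoose n) * (- 1) ^ n * (of_nat (2 * n) * x ^ (2 * n - 1) * \<xi>)) (at 0)"
      by (auto intro!: derivative_eq_intros)
    moreover have "(l gchoose n) * (- 1) ^ n * (x + t * \<xi>) ^ (2 * n)
        = fps_nth (binomial_factor l (x + t * \<xi>)) n" for t
      by (simp add: binomial_factor_def power_minus[of "_\<^sup>2"] power_mult)
    ultimately show "((\<lambda>t. fps_nth (binomial_factor l (x + t * \<xi>)) n) has_field_derivative
        fps_nth (fps_const \<xi> * d) n) (at 0)"
      by (simp add: d_def mult_ac)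
  qed
qed

lemma log_factor_deriv:
  "fps_deriv_at (\<lambda>t. log_factor l (x + t * \<xi>)) (fps_const \<xi> * log_factor_deriv l x) 0"
  unfolding fps_deriv_at_def
proof
  fix n
  have "((\<lambda>t. - 2 * l * (x + t * \<xi>) ^ (2 * n - 1)) has_field_derivative
      - 2 * l * (of_nat (2 * n - 1) * x ^ (2 * n - 1 - 1) * \<xi>)) (at 0)"
    by (auto intro!: derivative_eq_intros)
  then show "((\<lambda>t. fps_nth (log_factor l (x + t * \<xi>)) n) has_field_derivative
      fps_nth (fps_const \<xi> * log_factor_deriv l x) n) (at 0)"
    by (cases "n = 0") (simp_all add: log_factor_def log_factor_deriv_def mult_ac numeral_2_eq_2)
qed

section \<open>Gradient and Hessian of the coefficients of the generating function\<close>

lemma gen_fun_deriv: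
  "fps_deriv_at (\<lambda>t. gen_fun l (x + t *s \<xi>))
    (gen_fun l x * (\<Sum>j\<in>UNIV. fps_const (\<xi> $ j) * log_factor (l j) (x $ j))) 0"
proof -
  have "fps_deriv_at (\<lambda>t. \<Prod>j\<in>UNIV. binomial_factor (l j) (x $ j + t * \<xi> $ j))
    ((\<Prod>j\<in>UNIV. binomial_factor (l j) (x $ j + 0 * \<xi> $ j)) *
     (\<Sum>j\<in>UNIV. fps_const (\<xi> $ j) * log_factor (l j) (x $ j))) 0"
    using binomial_factor_deriv by (intro fps_deriv_at_prod) simp_all
  then show ?thesis by (simp add: gen_fun_def)
qed

definition grad :: "('n::finite \<Rightarrow> complex) \<Rightarrow> nat \<Rightarrow> complex ^ 'n \<Rightarrow> 'n \<Rightarrow> complex" where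
  "grad l k x i = fps_nth (gen_fun l x * log_factor (l i) (x $ i)) k"

text \<open>Differentiating \<Phi> L_i in x_j gives \<Phi> L_i L_j, and on the diagonal also \<Phi>
  times the derivative of L_i, where L_i is the logarithmic derivative of \<Phi> in x_i.\<close>

definition hess :: "('n::finite \<Rightarrow> complex) \<Rightarrow> nat \<Rightarrow> complex ^ 'n \<Rightarrow> 'n \<Rightarrow> 'n \<Rightarrow> complex" where
  "hess l k x i j = fps_nth (gen_fun l x * (log_factor (l i) (x $ i) * log_factor (l j) (x $ j)
     + (if i = j then log_factor_deriv (l i) (x $ i) else 0))) k"

lemma gen_fun_dir_deriv:
  "has_dir_deriv (\<lambda>y. fps_nth (gen_fun l y) k) \<xi> x (\<Sum>j\<in>UNIV. \<xi> $ j * grad l k x j)"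
proof -
  have "gen_fun l x * (\<Sum>j\<in>UNIV. fps_const (\<xi> $ j) * log_factor (l j) (x $ j))
     = (\<Sum>j\<in>UNIV. fps_const (\<xi> $ j) * (gen_fun l x * log_factor (l j) (x $ j)))"
    by (simp add: sum_distrib_left mult_ac)
  then show ?thesis
    using gen_fun_deriv[of l x \<xi>]
    by (simp add: fps_deriv_at_def has_dir_deriv_def grad_def fps_sum_nth)
qed

lemma grad_dir_deriv:
  "has_dir_deriv (\<lambda>y. grad l k y i) \<xi> x (\<Sum>j\<in>UNIV. \<xi> $ j * hess l k x i j)"
proof -
  let ?L = "\<lambda>j. log_factor (l j) (x $ j)"
  have "fps_deriv_at (\<lambda>t. gen_fun l (x + t *s \<xi>) * log_factor (l i) (x $ i + t * \<xi> $ i))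
     (gen_fun l x * (\<Sum>j\<in>UNIV. fps_const (\<xi> $ j) * ?L j) * ?L i
       + gen_fun l x * (fps_const (\<xi> $ i) * log_factor_deriv (l i) (x $ i))) 0"
    using fps_deriv_at_mult[OF gen_fun_deriv[of l x \<xi>] log_factor_deriv[of "l i" "x $ i" "\<xi> $ i"]] by simp
  moreover have "gen_fun l x * (\<Sum>j\<in>UNIV. fps_const (\<xi> $ j) * ?L j) * ?L i
       + gen_fun l x * (fps_const (\<xi> $ i) * log_factor_deriv (l i) (x $ i))
     = (\<Sum>j\<in>UNIV. fps_const (\<xi> $ j) * (gen_fun l x *
          (?L i * ?L j + (if i = j then log_factor_deriv (l i) (x $ i) else 0))))"
  proof -
    have "(\<Sum>j\<in>UNIV. fps_const (\<xi> $ j) * (gen_fun l x *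
          (?L i * ?L j + (if i = j then log_factor_deriv (l i) (x $ i) else 0))))
       = (\<Sum>j\<in>UNIV. gen_fun l x * (fps_const (\<xi> $ j) * ?L j) * ?L i
          + (if i = j then gen_fun l x * (fps_const (\<xi> $ i) * log_factor_deriv (l i) (x $ i)) else 0))"
      by (intro sum.cong refl) (auto simp: algebra_simps)
    then show ?thesis
      by (simp add: sum.distrib sum_distrib_left sum_distrib_right)
  qed
  ultimately show ?thesis
    by (simp add: fps_deriv_at_def has_dir_deriv_def grad_def hess_def fps_sum_nth)
qed

text \<open>The partial fraction identity multiplied by the generating function, read off at
  X^k.\<close>

lemma hess_mixed:
  assumes "i \<noteq> j"
  shows "((x $ i)\<^sup>2 - (x $ j)\<^sup>2) * hess l k x i j
    = 2 * l i * x $ i * grad l k x j - 2 * l j * x $ j * grad l k x i"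
proof -
  let ?L = "\<lambda>j. log_factor (l j) (x $ j)"
  have "((x $ i)\<^sup>2 - (x $ j)\<^sup>2) * hess l k x i j
      = fps_nth (gen_fun l x * (fps_const ((x $ i)\<^sup>2 - (x $ j)\<^sup>2) * (?L i * ?L j))) k"
    using assms unfolding hess_def fps_mult_left_const_nth[symmetric] by (simp add: mult_ac)
  also have "gen_fun l x * (fps_const ((x $ i)\<^sup>2 - (x $ j)\<^sup>2) * (?L i * ?L j))
     = fps_const (2 * l i * x $ i) * (gen_fun l x * ?L j) - fps_const (2 * l j * x $ j) * (gen_fun l x * ?L i)"
    unfolding log_factor_mult by (simp add: algebra_simps)
  finally show ?thesis by (simp add: grad_def)
qed

text \<open>Each power of X comes with x-degree two, and these weights add in the Cauchy
  product.\<close>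

lemma gen_fun_scale: "fps_nth (gen_fun l (s *s x)) n = s ^ (2 * n) * fps_nth (gen_fun l x) n"
proof -
  have "fps_nth (\<Prod>j\<in>J. binomial_factor (l j) (s * x $ j)) n
      = s ^ (2 * n) * fps_nth (\<Prod>j\<in>J. binomial_factor (l j) (x $ j)) n" if "finite J" for J
    using that
  proof (induction J arbitrary: n rule: finite_induct)
    case empty
    then show ?case by simp
  next
    case (insert j J)
    have factor: "fps_nth (binomial_factor (l j) (s * x $ j)) m
        = s ^ (2 * m) * fps_nth (binomial_factor (l j) (x $ j)) m" for m
      by (simp add: binomial_factor_def power_mult_distrib power_minus[of "_ * _"] power_minus[of "_\<^sup>2"] power_mult)
    have pow: "s ^ (2 * m) * s ^ (2 * (n - m)) = s ^ (2 * n)" if "m \<in> {0..n}" for m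
    proof -
      have "2 * m + 2 * (n - m) = 2 * n" using that by simp
      then show ?thesis by (metis power_add)
    qed
    have rearrange: "s ^ (2 * m) * y * (s ^ (2 * (n - m)) * z) = s ^ (2 * n) * (y * z)"
      if "m \<in> {0..n}" for m y z
    proof -
      have "s ^ (2 * m) * y * (s ^ (2 * (n - m)) * z) = s ^ (2 * m) * s ^ (2 * (n - m)) * (y * z)"
        by (simp only: mult_ac)
      then show ?thesis unfolding pow[OF that] .
    qed
    show ?case
      unfolding prod.insert[OF insert.hyps] fps_mult_nth factor insert.IH sum_distrib_left
      by (intro sum.cong refl rearrange)
  qed
  then show ?thesis by (simp add: gen_fun_def)
qed

lemma log_factor_0: "fps_nth (log_factor l x) 0 = 0"
  by (simp add: log_factor_def)

lemma grad_eq: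
  assumes "k > 0"
  shows "grad l k x i = (\<Sum>m<k. fps_nth (gen_fun l x) m * (- 2 * l i * x $ i ^ (2 * (k - m) - 1)))"
proof -
  have "grad l k x i = (\<Sum>m=0..k. fps_nth (gen_fun l x) m * fps_nth (log_factor (l i) (x $ i)) (k - m))"
    by (simp add: grad_def fps_mult_nth)
  also have "\<dots> = (\<Sum>m<k. fps_nth (gen_fun l x) m * fps_nth (log_factor (l i) (x $ i)) (k - m))"
    \<comment> \<open>The term m = k drops out because a logarithmic derivative has no constant
      term; for m < k the exponent 2 (k - m) - 1 is not truncated.\<close>
    by (rule sum.mono_neutral_right) (auto simp: log_factor_0 not_less)
  also have "\<dots> = (\<Sum>m<k. fps_nth (gen_fun l x) m * (- 2 * l i * x $ i ^ (2 * (k - m) - 1)))"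
    by (intro sum.cong) (auto simp: log_factor_def)
  finally show ?thesis .
qed

lemma grad_scale:
  assumes "k > 0"
  shows "grad l k (s *s x) i = s ^ (2 * k - 1) * grad l k x i"
  unfolding grad_eq[OF assms] sum_distrib_left
proof (intro sum.cong refl)
  fix m assume "m \<in> {..<k}"
  then have "2 * m + (2 * (k - m) - 1) = 2 * k - 1" by auto
  then have "s ^ (2 * k - 1) = s ^ (2 * m) * s ^ (2 * (k - m) - 1)"
    by (metis power_add)
  then show "fps_nth (gen_fun l (s *s x)) m * (- 2 * l i * (s *s x) $ i ^ (2 * (k - m) - 1))
      = s ^ (2 * k - 1) * (fps_nth (gen_fun l x) m * (- 2 * l i * x $ i ^ (2 * (k - m) - 1)))"
    by (simp add: gen_fun_scale power_mult_distrib mult_ac)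
qed

text \<open>The gradient is homogeneous of degree 2 k - 1. Differentiating it at x + t x = (1 + t) x
  by the chain rule and by homogeneity gives both sides, and the degree becomes the value of
  \<kappa>.\<close>

lemma grad_euler:
  assumes "k > 0"
  shows "(\<Sum>j\<in>UNIV. x $ j * hess l k x i j) = (2 * of_nat k - 1) * grad l k x i"
proof -
  have "((\<lambda>t. grad l k (x + t *s x) i) has_field_derivative (\<Sum>j\<in>UNIV. x $ j * hess l k x i j)) (at 0)"
    using grad_dir_deriv[of l k i x x] by (simp add: has_dir_deriv_def)
  moreover have "grad l k (x + t *s x) i = (1 + t) ^ (2 * k - 1) * grad l k x i" for t
  proof -
    have "x + t *s x = (1 + t) *s x" by (simp add: vec_eq_iff algebra_simps)
    show ?thesis unfolding \<open>x + t *s x = (1 + t) *s x\<close> by (rule grad_scale[OF assms])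
  qed
  moreover have "((\<lambda>t. (1 + t) ^ (2 * k - 1) * grad l k x i) has_field_derivative
      of_nat (2 * k - 1) * grad l k x i) (at 0)"
    by (auto intro!: derivative_eq_intros)
  ultimately have "(\<Sum>j\<in>UNIV. x $ j * hess l k x i j) = of_nat (2 * k - 1) * grad l k x i"
    by (simp add: DERIV_unique)
  then show ?thesis using assms by (simp add: of_nat_diff)
qed

section \<open>Polynomiality of the potentials and their gradients\<close>

lemma polynomial_map_gen_fun: "polynomial_map (\<lambda>x. fps_nth (gen_fun l x) n)"
proof -
  have "polynomial_map (\<lambda>x. fps_nth (\<Prod>j\<in>J. binomial_factor (l j) (x $ j)) n)" if "finite J" for J
    using that
  proof (induction J arbitrary: n rule: finite_induct)
    case empty
    then show ?case by (simp add: polynomial_map_const)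
  next
    case (insert j J)
    have "polynomial_map (\<lambda>x. (l j gchoose m) * (- 1 * (x $ j)\<^sup>2) ^ m)" for m
      by (intro polynomial_map_intros)
    then have "polynomial_map (\<lambda>x. fps_nth (binomial_factor (l j) (x $ j)) m)" for m
      by (simp add: binomial_factor_def)
    then show ?case
      using insert by (simp add: fps_mult_nth polynomial_map_sum polynomial_map_mult)
  qed
  then show ?thesis by (simp add: gen_fun_def)
qed

lemma polynomial_map_grad:
  assumes "k > 0"
  shows "polynomial_map (\<lambda>x. grad l k x i)"
  unfolding grad_eq[OF assms]
  by (intro polynomial_map_intros polynomial_map_gen_fun)

section \<open>Independence and the contour integral\<close>

text \<open>Independence of a set does not see repetitions, so injectivity is shown as well: equal
  members would give a relation with coefficients 1 and - 1.\<close>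

lemma family_independent:
  fixes v :: "'k \<Rightarrow> complex ^ 'n::finite"
  assumes "finite I" and indep: "\<And>a k. (\<Sum>k\<in>I. a k *s v k) = 0 \<Longrightarrow> k \<in> I \<Longrightarrow> a k = 0"
  shows "inj_on v I" "vec.independent (v ` I)"
proof -
  show inj: "inj_on v I"
  proof (rule inj_onI, rule ccontr)
    fix k l assume kl: "k \<in> I" "l \<in> I" "v k = v l" "k \<noteq> l"
    define a :: "'k \<Rightarrow> complex" where "a = (\<lambda>m. if m = k then 1 else if m = l then - 1 else 0)"
    have "(\<Sum>m\<in>I. a m *s v m) = (\<Sum>m\<in>{k, l}. a m *s v m)"
      using kl \<open>finite I\<close> by (intro sum.mono_neutral_right) (auto simp: a_def)
    also have "\<dots> = 0"
      using kl by (simp add: a_def vector_smult_lneg)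
    finally have "a k = 0" using indep kl(1) by blast
    then show False by (simp add: a_def)
  qed
  show "vec.independent (v ` I)"
  proof
    assume "vec.dependent (v ` I)"
    then obtain u where u: "\<exists>w\<in>v ` I. u w \<noteq> 0" "(\<Sum>w\<in>v ` I. u w *s w) = 0"
      using vec.dependent_finite[of "v ` I"] \<open>finite I\<close> by auto
    then have "(\<Sum>k\<in>I. u (v k) *s v k) = 0"
      by (simp add: sum.reindex[OF inj])
    then show False using indep[of "\<lambda>k. u (v k)"] u(1) by blast
  qed
qed

text \<open>At the largest index \<open>m\<close> with b_m \<noteq> 0, the coefficient of degree m -
  1 in the relation comes from \<open>r m\<close> alone, which is monic of that degree.\<close>

lemma triangular_polys_independent:
  fixes r :: "nat \<Rightarrow> 'a::idom poly"
  assumes deg: "\<And>k. k \<in> {1..n} \<Longrightarrow> degree (r k) \<le> k - 1"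
    and lead: "\<And>k. k \<in> {1..n} \<Longrightarrow> coeff (r k) (k - 1) = 1"
    and zero: "(\<Sum>k=1..n. smult (b k) (r k)) = 0" and k: "k \<in> {1..n}"
  shows "b k = 0"
proof (rule ccontr)
  assume "b k \<noteq> 0"
  define K where "K = {k\<in>{1..n}. b k \<noteq> 0}"
  have K: "finite K" "K \<noteq> {}" using k \<open>b k \<noteq> 0\<close> by (auto simp: K_def)
  define m where "m = Max K"
  have m: "m \<in> {1..n}" "b m \<noteq> 0" using Max_in[OF K] by (auto simp: m_def K_def)
  have "b j * coeff (r j) (m - 1) = 0" if "j \<in> {1..n} - {m}" for j
  proof (cases "j < m")
    case True
    then have "degree (r j) < m - 1" using deg[of j] that by auto
    then show ?thesis by (simp add: coeff_eq_0)
  next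
    case False
    then have "j \<notin> K" using Max_ge[OF K(1), of j] that by (auto simp: m_def)
    then show ?thesis using that by (auto simp: K_def)
  qed
  then have "(\<Sum>j\<in>{1..n} - {m}. b j * coeff (r j) (m - 1)) = 0"
    by (rule sum.neutral[OF ballI])
  moreover have "0 = coeff (\<Sum>k=1..n. smult (b k) (r k)) (m - 1)"
    by (subst zero) simp
  then have "0 = (\<Sum>j=1..n. b j * coeff (r j) (m - 1))"
    by (simp add: coeff_sum)
  moreover have "(\<Sum>j=1..n. b j * coeff (r j) (m - 1))
      = b m * coeff (r m) (m - 1) + (\<Sum>j\<in>{1..n} - {m}. b j * coeff (r j) (m - 1))"
    using m(1) by (intro sum.remove) auto
  ultimately show False
    using m(2) lead[OF m(1)] by simp
qed

text \<open>The polynomial whose value at x_i^2 is the factor left in \<open>grad l k x i\<close>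
  after - 2 l_i x_i is taken out; it is the same for all \<open>i\<close>.\<close>

definition grad_poly :: "('n::finite \<Rightarrow> complex) \<Rightarrow> nat \<Rightarrow> complex ^ 'n \<Rightarrow> complex poly" where
  "grad_poly l k x = (\<Sum>m<k. monom (fps_nth (gen_fun l x) m) (k - 1 - m))"

lemma degree_grad_poly: "degree (grad_poly l k x) \<le> k - 1"
  unfolding grad_poly_def by (rule degree_sum_le) (auto intro: order_trans[OF degree_monom_le])

lemma gen_fun_0: "fps_nth (gen_fun l x) 0 = 1"
proof -
  have "fps_nth (\<Prod>j\<in>J. binomial_factor (l j) (x $ j)) 0 = 1" if "finite J" for J
    using that by (induction J rule: finite_induct) (simp_all add: binomial_factor_def)
  then show ?thesis by (simp add: gen_fun_def)
qed

lemma coeff_grad_poly: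
  assumes "k > 0"
  shows "coeff (grad_poly l k x) (k - 1) = 1"
proof -
  have "coeff (grad_poly l k x) (k - 1) = (\<Sum>m<k. if m = 0 then fps_nth (gen_fun l x) 0 else 0)"
    unfolding grad_poly_def coeff_sum using assms by (intro sum.cong) auto
  then show ?thesis using assms by (simp add: gen_fun_0)
qed

lemma grad_eq_poly:
  assumes "k > 0"
  shows "grad l k x i = - 2 * l i * x $ i * poly (grad_poly l k x) ((x $ i)\<^sup>2)"
proof -
  have "x $ i ^ (2 * (k - m) - 1) = x $ i * ((x $ i)\<^sup>2) ^ (k - 1 - m)" if "m < k" for m
  proof -
    have "2 * (k - m) - 1 = Suc (2 * (k - 1 - m))" using that by simp
    then show ?thesis by (simp add: power_mult)
  qed
  then show ?thesis
    unfolding grad_eq[OF assms] grad_poly_def poly_sum poly_monom sum_distrib_left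
    by (intro sum.cong) (auto simp: mult_ac)
qed

text \<open>
  The inversion \<open>w = 1/z\<close> reverses the orientation of the circle, which cancels the sign in
  \<open>dz = - dw / w\<^sup>2\<close>.
\<close>

lemma has_contour_integral_circlepath_inversion:
  assumes "R > 0"
    and "((\<lambda>w. f (1 / w) / w\<^sup>2) has_contour_integral I) (circlepath 0 (1 / R))"
  shows "(f has_contour_integral I) (circlepath 0 R)"
proof -
  \<comment> \<open>The small circle run backwards is t \<mapsto> 1 / (R e^(2 \<pi> i t)), the
    pointwise inverse of the large circle, so the two integrands in \<open>t\<close> agree
    pointwise.\<close>
  define p where "p = part_circlepath 0 (1 / R) (2 * pi) 0"
  have "((\<lambda>w. f (1 / w) / w\<^sup>2) has_contour_integral - I) p"
    using has_contour_integral_reversepath[OF _ assms(2)]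
    by (simp add: p_def circlepath_def)
  then have "((\<lambda>t. - (f (1 / p t) / (p t)\<^sup>2 * vector_derivative p (at t within {0..1}))) has_integral I) {0..1}"
    unfolding has_contour_integral_def by (auto dest: has_integral_neg)
  moreover have "- (f (1 / p t) / (p t)\<^sup>2 * vector_derivative p (at t within {0..1}))
      = f (circlepath 0 R t) * vector_derivative (circlepath 0 R) (at t within {0..1})"
    if "t \<in> {0..1}" for t
  proof -
    define e where "e = exp (2 * of_real pi * \<i> * of_real t)"
    have e: "e \<noteq> 0" by (simp add: e_def)
    have "exp (\<i> * of_real (linepath (2 * pi) 0 t)) = exp (2 * of_real pi * \<i> - 2 * of_real pi * \<i> * of_real t)"
      by (simp add: linepath_def algebra_simps)
    also have "\<dots> = 1 / e"
      by (simp add: exp_diff e_def)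
    finally have exp: "exp (\<i> * of_real (linepath (2 * pi) 0 t)) = 1 / e" .
    have p: "p t = 1 / (of_real R * e)"
      unfolding p_def part_circlepath_def exp by simp
    have pd: "vector_derivative p (at t within {0..1}) = - (2 * of_real pi * \<i> / (of_real R * e))"
      unfolding p_def using that by (subst vector_derivative_part_circlepath01) (auto simp: exp)
    have c: "circlepath 0 R t = of_real R * e"
      by (simp add: circlepath e_def)
    have cd: "vector_derivative (circlepath 0 R) (at t within {0..1}) = 2 * of_real pi * \<i> * of_real R * e"
      using that by (simp add: vector_derivative_circlepath01 e_def)
    show ?thesis
      unfolding p pd c cd using e \<open>R > 0\<close> by (simp add: field_simps power2_eq_square)
  qed
  ultimately show ?thesis
    unfolding has_contour_integral_def by (rule has_integral_eq[rotated])
qed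

text \<open>This links the formal series to the principal branches: near v = 0 each power is its
  binomial series with - x_j^2 v substituted.\<close>

lemma gen_fun_expansion:
  "(\<lambda>v. \<Prod>j\<in>UNIV. (1 - (x $ j)\<^sup>2 * v) powr l j) has_fps_expansion gen_fun l x"
  unfolding gen_fun_def
proof (rule has_fps_expansion_prod)
  fix j
  have "(\<lambda>v. - (x $ j)\<^sup>2 * v) has_fps_expansion fps_const (- (x $ j)\<^sup>2) * fps_X"
    by (intro fps_expansion_intros)
  then have "((\<lambda>v. (1 + v) powr l j) \<circ> (\<lambda>v. - (x $ j)\<^sup>2 * v))
      has_fps_expansion (fps_binomial (l j) oo (fps_const (- (x $ j)\<^sup>2) * fps_X))"
    by (intro has_fps_expansion_compose has_fps_expansion_binomial_complex) simp_all
  moreover have "fps_binomial (l j) oo (fps_const (- (x $ j)\<^sup>2) * fps_X) = binomial_factor (l j) (x $ j)"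
    by (rule fps_ext, simp only: fps_nth_compose_linear binomial_factor_def fps_nth_Abs_fps fps_binomial_nth, rule mult.commute)
  ultimately show "(\<lambda>v. (1 - (x $ j)\<^sup>2 * v) powr l j) has_fps_expansion binomial_factor (l j) (x $ j)"
    by (simp add: o_def)
qed

text \<open>With w = 1/z the integral becomes that of g(w) / w^(2 k + 1) over a small circle, and
  Cauchy's formula yields the coefficient of w^(2 k) in \<open>g\<close>, which is the k-th
  coefficient in w^2.\<close>

lemma gen_fun_contour_integral:
  fixes x :: "complex ^ 'n::finite"
  assumes R: "\<And>j. cmod (x $ j) < R" and "k > 0"
  shows "((\<lambda>z. z ^ (2 * k - 1) * (\<Prod>j\<in>UNIV. (1 - (x $ j)\<^sup>2 / z\<^sup>2) powr l j)) has_contour_integral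
    2 * of_real pi * \<i> * fps_nth (gen_fun l x) k) (circlepath 0 R)"
proof -
  have "R > 0" using R[of undefined] by (meson norm_ge_zero le_less_trans)
  define g where "g w = (\<Prod>j\<in>UNIV. (1 - (x $ j)\<^sup>2 * w\<^sup>2) powr l j)" for w
  \<comment> \<open>On the closed disc |x_j w| < 1, so the base has positive real part and avoids
    the branch cut.\<close>
  have "1 - (x $ j)\<^sup>2 * w\<^sup>2 \<notin> \<real>\<^sub>\<le>\<^sub>0" if "w \<in> cball 0 (1 / R)" for j w
  proof -
    have "cmod w \<le> 1 / R" using that by simp
    then have "cmod (x $ j) * cmod w \<le> cmod (x $ j) * (1 / R)"
      by (intro mult_left_mono) auto
    also have "\<dots> < 1" using R[of j] \<open>R > 0\<close> by simp
    finally have "cmod (x $ j * w) < 1" by (simp add: norm_mult)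
    then have "cmod ((x $ j * w)\<^sup>2) < 1"
      by (simp add: norm_power power_less_one_iff)
    then have "Re ((x $ j * w)\<^sup>2) < 1"
      using complex_Re_le_cmod[of "(x $ j * w)\<^sup>2"] by linarith
    then show ?thesis
      by (simp add: complex_nonpos_Reals_iff power_mult_distrib)
  qed
  then have hol: "g holomorphic_on cball 0 (1 / R)"
    unfolding g_def by (auto intro!: holomorphic_intros)
  have "((\<lambda>v. \<Prod>j\<in>UNIV. (1 - (x $ j)\<^sup>2 * v) powr l j) \<circ> (\<lambda>w. w ^ 2))
      has_fps_expansion (gen_fun l x oo fps_X ^ 2)"
    by (intro has_fps_expansion_compose gen_fun_expansion fps_expansion_intros) simp
  then have "g has_fps_expansion (gen_fun l x oo fps_X ^ 2)"
    by (simp add: g_def[abs_def] o_def)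
  from fps_nth_fps_expansion[OF this, of "2 * k"]
  have coeff: "fps_nth (gen_fun l x) k = (deriv ^^ (2 * k)) g 0 / fact (2 * k)"
    by (simp add: fps_nth_compose_X_power)
  have "continuous_on (cball 0 (1 / R)) g" "g holomorphic_on ball 0 (1 / R)" "0 \<in> ball 0 (1 / R)"
    using hol \<open>R > 0\<close> holomorphic_on_imp_continuous_on holomorphic_on_subset[OF hol ball_subset_cball]
    by auto
  from Cauchy_has_contour_integral_higher_derivative_circlepath[OF this, of "2 * k"]
  have "((\<lambda>w. g w / w ^ Suc (2 * k)) has_contour_integral
      2 * of_real pi * \<i> * fps_nth (gen_fun l x) k) (circlepath 0 (1 / R))"
    by (simp add: coeff)
  then have "((\<lambda>w. (1 / w) ^ (2 * k - 1) * (\<Prod>j\<in>UNIV. (1 - (x $ j)\<^sup>2 / (1 / w)\<^sup>2) powr l j) / w\<^sup>2)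
      has_contour_integral 2 * of_real pi * \<i> * fps_nth (gen_fun l x) k) (circlepath 0 (1 / R))"
  proof (rule has_contour_integral_eq)
    fix w assume "w \<in> path_image (circlepath 0 (1 / R))"
    then have "w \<noteq> 0" using \<open>R > 0\<close> by auto
    \<comment> \<open>Of the exponent 2 k + 1, the part 2 k - 1 comes from z^(2 k - 1) and 2 from
      dz; k > 0 prevents truncation.\<close>
    have "Suc (2 * k) = 2 * k - 1 + 2" using \<open>k > 0\<close> by simp
    then have "w ^ Suc (2 * k) = w ^ (2 * k - 1) * w\<^sup>2"
      by (metis power_add)
    then show "g w / w ^ Suc (2 * k)
        = (1 / w) ^ (2 * k - 1) * (\<Prod>j\<in>UNIV. (1 - (x $ j)\<^sup>2 / (1 / w)\<^sup>2) powr l j) / w\<^sup>2"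
      by (simp add: g_def power_divide)
  qed
  then show ?thesis
    by (rule has_contour_integral_circlepath_inversion[OF \<open>R > 0\<close>])
qed

section \<open>Harmonicity\<close>

lemma sum_odd_numbers: "(\<Sum>k=1..n. 2 * of_nat k - 1) = (of_nat (n\<^sup>2) :: complex)"
  by (induction n) (simp_all add: power2_eq_square algebra_simps)

context B_parameters
begin

section \<open>The fields, their potentials and their independence\<close>

abbreviation exponents :: "nat \<Rightarrow> 'n \<Rightarrow> complex" where
  "exponents k \<equiv> \<lambda>j. B_exponent c\<^sub>0 c k (c j)"

text \<open>The gradient of the potential, converted to a vector by inverting the diagonal canonical
  form.\<close>

definition field :: "nat \<Rightarrow> (complex, 'n) vec \<Rightarrow> (complex, 'n) vec" where
  "field k x = (\<chi> i. grad (exponents k) k x i / (2 * \<sigma> * c i))"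

text \<open>The relation 2 \<lambda>_i = \<kappa> c_i / \<sigma> with \<kappa> = 2 k - 1 matches the
  mixed derivatives of the potential with those required by the system.\<close>

lemma exponents_eq: "2 * exponents k i = (2 * of_nat k - 1) / \<sigma> * c i"
proof -
  have "2 * (p * q / (2 * s)) = p / s * q" for p q s :: complex by simp
  then show ?thesis unfolding B_exponent_def \<sigma>_def .
qed

lemma solves_system_field:
  assumes "k > 0"
  shows "solves_system (B_system c\<^sub>0 c) (2 * of_nat k - 1) (field k)"
  unfolding field_def
proof (rule solves_system_B_system[OF grad_dir_deriv _ grad_euler[OF assms]])
  fix x i j assume "i \<noteq> (j :: 'n)"
  show "((x $ i)\<^sup>2 - (x $ j)\<^sup>2) * hess (exponents k) k x i j
      = (2 * of_nat k - 1) / \<sigma> *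
        (c i * x $ i * grad (exponents k) k x j - c j * x $ j * grad (exponents k) k x i)"
    unfolding hess_mixed[OF \<open>i \<noteq> j\<close>] exponents_eq by (simp only: right_diff_distrib mult.assoc)
qed

lemma polynomial_field_field:
  assumes "k > 0"
  shows "polynomial_field (field k)"
proof -
  have "polynomial_map (\<lambda>x. grad (exponents k) k x i * (1 / (2 * \<sigma> * c i)))" for i
    by (intro polynomial_map_mult polynomial_map_grad polynomial_map_const assms)
  then show ?thesis by (simp add: polynomial_field_def field_def)
qed

lemma is_potential_field:
  "is_potential (B_system c\<^sub>0 c) (field k) (\<lambda>x. fps_nth (gen_fun (exponents k) x) k)"
proof -
  have "canonical_form (B_system c\<^sub>0 c) (field k x) \<eta>
      = (\<Sum>j\<in>UNIV. \<eta> $ j * grad (exponents k) k x j)" for x \<eta>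
    using sigma_neq_0 c_nonzero by (simp add: canonical_form_B_system field_def mult_ac)
  then show ?thesis
    by (simp add: is_potential_def polynomial_map_gen_fun gen_fun_dir_deriv)
qed

text \<open>The quotient \<lambda>_i / c_i does not depend on \<open>i\<close>, so apart from the
  factor x_i all coordinates are values of one polynomial.\<close>

lemma field_eq_poly:
  assumes "k > 0"
  shows "field k x $ i = - x $ i / (2 * \<sigma>\<^sup>2) *
    ((2 * of_nat k - 1) * poly (grad_poly (exponents k) k x) ((x $ i)\<^sup>2))"
proof -
  have "field k x $ i = - x $ i * ((2 * exponents k i) / (2 * \<sigma> * c i)
      * poly (grad_poly (exponents k) k x) ((x $ i)\<^sup>2))"
    by (simp add: field_def grad_eq_poly[OF assms])
  also have "(2 * exponents k i) / (2 * \<sigma> * c i) = (2 * of_nat k - 1) / (2 * \<sigma>\<^sup>2)"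
    unfolding exponents_eq using c_nonzero sigma_neq_0 by (simp add: power2_eq_square)
  finally show ?thesis by simp
qed

text \<open>
  At a point where the squares \<open>x\<^sub>i\<^sup>2\<close> are distinct and nonzero, a linear relation between the fields
  amounts to a polynomial of degree less than \<open>n\<close> vanishing at the \<open>n\<close> numbers \<open>x\<^sub>i\<^sup>2\<close>.
\<close>

lemma fields_independent:
  assumes x: "\<And>i. x $ i \<noteq> 0" "inj (\<lambda>i. (x $ i)\<^sup>2)"
    and zero: "(\<Sum>k=1..CARD('n). a k *s field k x) = 0" and k: "k \<in> {1..CARD('n)}"
  shows "a k = 0"
proof -
  \<comment> \<open>The odd number 2 k - 1 from the exponents is absorbed into the coefficient; it
    is nonzero by parity, so \<open>b k = 0\<close> gives \<open>a k = 0\<close>.\<close>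
  define b where "b k = a k * (2 * of_nat k - 1)" for k
  define P where "P = (\<Sum>k=1..CARD('n). smult (b k) (grad_poly (exponents k) k x))"
  have root: "poly P ((x $ i)\<^sup>2) = 0" for i
  proof -
    have "0 = (\<Sum>k=1..CARD('n). a k *s field k x) $ i"
      by (subst zero) simp
    also have "\<dots> = (\<Sum>k=1..CARD('n). - x $ i / (2 * \<sigma>\<^sup>2) *
        (b k * poly (grad_poly (exponents k) k x) ((x $ i)\<^sup>2)))"
      unfolding sum_component vector_smult_component b_def
      by (intro sum.cong refl) (subst field_eq_poly, simp, simp only: mult_ac)
    also have "\<dots> = - x $ i / (2 * \<sigma>\<^sup>2) * poly P ((x $ i)\<^sup>2)"
      by (simp add: P_def poly_sum sum_distrib_left)
    finally show ?thesis using x(1)[of i] sigma_neq_0 by simp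
  qed
  have "degree P \<le> CARD('n) - 1"
    unfolding P_def
    by (intro degree_sum_le order_trans[OF degree_smult_le] order_trans[OF degree_grad_poly]) auto
  then have "degree P < CARD('n)"
    by (simp add: le_less_trans[OF _ diff_less])
  moreover have "CARD('n) = card (range (\<lambda>i. (x $ i)\<^sup>2))"
    using x(2) by (simp add: card_image)
  moreover have "card (range (\<lambda>i. (x $ i)\<^sup>2)) \<le> degree P" if "P \<noteq> 0"
  proof -
    have "range (\<lambda>i. (x $ i)\<^sup>2) \<subseteq> {z. poly P z = 0}" using root by auto
    then show ?thesis
      using card_mono[OF poly_roots_finite[OF that]] card_poly_roots_bound[OF that] order_trans by blast
  qed
  ultimately have "P = 0" by linarith
  have "b k = 0"
  proof (rule triangular_polys_independent[where r = "\<lambda>m. grad_poly (exponents m) m x"])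
    show "(\<Sum>m=1..CARD('n). smult (b m) (grad_poly (exponents m) m x)) = 0"
      using \<open>P = 0\<close> by (simp only: P_def)
    show "degree (grad_poly (exponents m) m x) \<le> m - 1" for m
      by (rule degree_grad_poly)
    show "coeff (grad_poly (exponents m) m x) (m - 1) = 1" if "m \<in> {1..CARD('n)}" for m
      using that by (intro coeff_grad_poly) simp
  qed (rule k)
  moreover have "(of_nat (2 * k) :: complex) \<noteq> of_nat 1"
    unfolding of_nat_eq_iff by presburger
  ultimately show ?thesis by (simp add: b_def)
qed

lemma generically_fields_independent:
  "generically (\<lambda>x. inj_on (\<lambda>k. field k x) {1..CARD('n)} \<and>
     vec.independent ((\<lambda>k. field k x) ` {1..CARD('n)}))"
  unfolding generically_def
\<comment> \<open>Off the zero set of this polynomial the coordinates are nonzero and their squares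
  distinct, as the independence argument requires.\<close>
proof (intro exI[of _ "\<lambda>x. (\<Prod>i\<in>UNIV. x $ i) * (\<Prod>p\<in>{(i, j). i \<noteq> j}. (x $ fst p)\<^sup>2 - (x $ snd p)\<^sup>2)"]
    conjI allI impI)
  show "polynomial_map (\<lambda>x :: (complex, 'n) vec. (\<Prod>i\<in>UNIV. x $ i) *
      (\<Prod>p\<in>{(i, j). i \<noteq> j}. (x $ fst p)\<^sup>2 - (x $ snd p)\<^sup>2))"
    by (intro polynomial_map_intros)
next
  obtain f :: "'n \<Rightarrow> nat" where f: "inj f"
    using finite_imp_inj_to_nat_seg[of "UNIV :: 'n set"] by auto
  \<comment> \<open>Distinct positive integers as coordinates: \<open>Suc\<close> excludes 0, and
    squaring is injective on natural numbers.\<close>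
  define x :: "(complex, 'n) vec" where "x = (\<chi> i. of_nat (Suc (f i)))"
  have "(x $ i)\<^sup>2 \<noteq> (x $ j)\<^sup>2" if "i \<noteq> j" for i j
  proof -
    have "(Suc (f i))\<^sup>2 \<noteq> (Suc (f j))\<^sup>2" using f that by (simp add: inj_eq)
    then have "(of_nat ((Suc (f i))\<^sup>2) :: complex) \<noteq> of_nat ((Suc (f j))\<^sup>2)"
      unfolding of_nat_eq_iff .
    then show ?thesis by (simp only: x_def vec_lambda_beta of_nat_power not_False_eq_True)
  qed
  moreover have "x $ i \<noteq> 0" for i
    unfolding x_def vec_lambda_beta by (rule of_nat_neq_0)
  ultimately have "(\<Prod>i\<in>UNIV. x $ i) * (\<Prod>p\<in>{(i, j). i \<noteq> j}. (x $ fst p)\<^sup>2 - (x $ snd p)\<^sup>2) \<noteq> 0"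
    by (auto simp: prod_zero_iff)
  then show "\<exists>x :: (complex, 'n) vec. (\<Prod>i\<in>UNIV. x $ i) *
      (\<Prod>p\<in>{(i, j). i \<noteq> j}. (x $ fst p)\<^sup>2 - (x $ snd p)\<^sup>2) \<noteq> 0" ..
next
  fix x :: "(complex, 'n) vec"
  assume *: "(\<Prod>i\<in>UNIV. x $ i) * (\<Prod>p\<in>{(i, j). i \<noteq> j}. (x $ fst p)\<^sup>2 - (x $ snd p)\<^sup>2) \<noteq> 0"
  then have "x $ i \<noteq> 0" for i by (simp add: prod_zero_iff)
  moreover have "inj (\<lambda>i. (x $ i)\<^sup>2)"
  proof (rule injI, rule ccontr)
    fix i j assume "(x $ i)\<^sup>2 = (x $ j)\<^sup>2" "i \<noteq> j"
    then have "\<exists>p\<in>{(i, j). i \<noteq> j}. (x $ fst p)\<^sup>2 - (x $ snd p)\<^sup>2 = 0" by force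
    then show False using * by (simp add: prod_zero_iff)
  qed
  ultimately have "a k = 0" if "(\<Sum>k=1..CARD('n). a k *s field k x) = 0" "k \<in> {1..CARD('n)}" for a k
    using fields_independent that by blast
  then show "inj_on (\<lambda>k. field k x) {1..CARD('n)}"
      "vec.independent ((\<lambda>k. field k x) ` {1..CARD('n)})"
    using family_independent[of "{1..CARD('n)}" "\<lambda>k. field k x"] by auto
qed

text \<open>The sum of the \<kappa>'s is 1 + 3 + ... + (2 n - 1) = n^2, which equals the number of
  covectors n (n - 1) + n.\<close>

lemma harmonic_data_field: "harmonic_data (B_system c\<^sub>0 c) (\<lambda>k. 2 * of_nat k - 1) field"
  unfolding harmonic_data_def
proof (intro conjI ballI)
  fix k assume "k \<in> {1..CARD('n)}"
  then have "k > 0" by simp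
  have "(of_nat (2 * k) :: complex) \<noteq> of_nat 1"
    unfolding of_nat_eq_iff by presburger
  then show "2 * of_nat k - 1 \<noteq> (0 :: complex)" by simp
  show "polynomial_field (field k)" by (rule polynomial_field_field[OF \<open>k > 0\<close>])
  show "solves_system (B_system c\<^sub>0 c) (2 * of_nat k - 1) (field k)"
    by (rule solves_system_field[OF \<open>k > 0\<close>])
qed (rule generically_fields_independent, simp only: card_B_system sum_odd_numbers)

end

theorem theorem7:
  fixes c\<^sub>0 :: complex and c :: "'n::{finite,linorder} \<Rightarrow> complex"
  assumes "\<And>i. c i \<noteq> 0"
    and "c\<^sub>0 + (\<Sum>i\<in>UNIV. c i) \<noteq> 0"
    and "\<And>j. c j + c\<^sub>0 \<noteq> 0"
  shows "harmonic (B_system c\<^sub>0 c) \<and>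
    (\<exists>\<psi> F.
       harmonic_data (B_system c\<^sub>0 c) (\<lambda>k. 2 * of_nat k - 1) \<psi> \<and>
       (\<forall>k\<in>{1..CARD('n)}.
          is_potential (B_system c\<^sub>0 c) (\<psi> k) (F k) \<and>
          (\<forall>x R. (\<forall>j. cmod (x $ j) < R) \<longrightarrow>
             (B_integrand c\<^sub>0 c k x has_contour_integral 2 * of_real pi * \<i> * F k x)
               (circlepath 0 R))))"
proof -
  interpret B_parameters c\<^sub>0 c
    by unfold_locales (fact assms)+
  have integral: "(B_integrand c\<^sub>0 c k x has_contour_integral
      2 * of_real pi * \<i> * fps_nth (gen_fun (exponents k) x) k) (circlepath 0 R)"
    if "k \<in> {1..CARD('n)}" "\<forall>j. cmod (x $ j) < R" for k x R
    using gen_fun_contour_integral[of x R k "exponents k"] that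
    by (simp add: B_integrand_def[abs_def])
  have "harmonic (B_system c\<^sub>0 c)"
    unfolding harmonic_def using vee_system_B_system harmonic_data_field by blast
  moreover have "\<forall>k\<in>{1..CARD('n)}.
      is_potential (B_system c\<^sub>0 c) (field k) (\<lambda>x. fps_nth (gen_fun (exponents k) x) k) \<and>
      (\<forall>x R. (\<forall>j. cmod (x $ j) < R) \<longrightarrow>
         (B_integrand c\<^sub>0 c k x has_contour_integral
           2 * of_real pi * \<i> * fps_nth (gen_fun (exponents k) x) k) (circlepath 0 R))"
    using is_potential_field integral by blast
  ultimately show ?thesis
    using harmonic_data_field
    by (intro conjI exI[of _ field] exI[of _ "\<lambda>k x. fps_nth (gen_fun (exponents k) x) k"])
qed

end
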